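(* Let $G$ be a connected $K_4$-minor-free graph, and suppose that for every vertex $v \in V(G)$ an integer $f(v) \ge 2$ is given. Suppose that $c(G-S)\le \sum_{v\in S}(f(v)-1)$ for every nonempty $S\subseteq V(G)$, and let $x \in V(G)$. Then $G$ has a spanning tree $T$ such that $d_T(v)\le f(v)$ for all $v\in V(G)$ and $d_T(x)\le f(x)-1$.
   Context: All graphs are simple and finite. For a graph $G$, $c(G)$ denotes the number of connected components of $G$, $G-S$ denotes the subgraph induced on $V(G)-S$, and $d_T(v)$ denotes the degree of $v$ in $T$. A graph is $K_4$-minor-free if no graph isomorphic to $K_4$ can be obtained from it by edge contractions, edge deletions and vertex deletions. *)

theory Defs
  imports "Graph_Theory.Graph_Theory"
begin

text \<open>
  A finite simple graph is a \<^locale>\<open>pair_graph\<close>: an undirected edge \<open>uv\<close> is the pair of arcs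
  \<open>(u,v)\<close>, \<open>(v,u)\<close>.
\<close>

abbreviation minus_verts :: "'a pair_pre_digraph \<Rightarrow> 'a set \<Rightarrow> ('a, 'a \<times> 'a) pre_digraph" where
  "minus_verts G S \<equiv> with_proj G \<restriction> (pverts G - S)"

text \<open>For a symmetric digraph the strongly connected components are the connected components.\<close>

definition num_components :: "('a,'b) pre_digraph \<Rightarrow> nat" where
  "num_components G = card (pre_digraph.sccs G)"

text \<open>Every edge at \<open>v\<close> contributes exactly one arc leaving \<open>v\<close>.\<close>

abbreviation degree :: "'a pair_pre_digraph \<Rightarrow> 'a \<Rightarrow> nat" where
  "degree G v \<equiv> out_degree (with_proj G) v"

text \<open>
  \<^const>\<open>forest\<close>, and hence \<^const>\<open>tree\<close> and \<^const>\<open>spanning_tree\<close>, cannot be used for undirected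
  graphs: they are about directed cycles, and \<^const>\<open>pre_digraph.cycle\<close> admits the closed walk
  \<open>u, v, u\<close> along a single edge. The cycles of an undirected graph are those of length at least 3.
\<close>

definition undirected_tree :: "'a pair_pre_digraph \<Rightarrow> bool" where
  "undirected_tree T \<longleftrightarrow> pair_graph T \<and> connected (with_proj T) \<and>
     \<not> (\<exists>p. pre_digraph.cycle (with_proj T) p \<and> 3 \<le> length p)"

definition undirected_spanning_tree :: "'a pair_pre_digraph \<Rightarrow> 'a pair_pre_digraph \<Rightarrow> bool" where
  "undirected_spanning_tree T G \<longleftrightarrow> undirected_tree T \<and> spanning (with_proj T) (with_proj G)"

definition delete_vertex :: "'a \<Rightarrow> 'a pair_pre_digraph \<Rightarrow> 'a pair_pre_digraph" where
  "delete_vertex v G = \<lparr> pverts = pverts G - {v}, parcs = {(a,b) \<in> parcs G. a \<noteq> v \<and> b \<noteq> v} \<rparr>"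

definition delete_edge :: "'a \<Rightarrow> 'a \<Rightarrow> 'a pair_pre_digraph \<Rightarrow> 'a pair_pre_digraph" where
  "delete_edge u v G = \<lparr> pverts = pverts G, parcs = parcs G - {(u,v), (v,u)} \<rparr>"

text \<open>
  The vertex arising from the contraction of \<open>uv\<close> is again called \<open>u\<close>. The resulting loop is
  removed, and parallel edges are identified, so that the graph stays simple.
\<close>

definition merge :: "'a \<Rightarrow> 'a \<Rightarrow> 'a \<Rightarrow> 'a" where
  "merge u v w = (if w = v then u else w)"

definition contract_edge :: "'a \<Rightarrow> 'a \<Rightarrow> 'a pair_pre_digraph \<Rightarrow> 'a pair_pre_digraph" where
  "contract_edge u v G =
     \<lparr> pverts = pverts G - {v},
       parcs = {(merge u v a, merge u v b) | a b. (a,b) \<in> parcs G \<and> merge u v a \<noteq> merge u v b} \<rparr>"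

inductive minor_step :: "'a pair_pre_digraph \<Rightarrow> 'a pair_pre_digraph \<Rightarrow> bool" where
  vertex_deletion: "v \<in> pverts G \<Longrightarrow> minor_step G (delete_vertex v G)"
| edge_deletion: "(u,v) \<in> parcs G \<Longrightarrow> minor_step G (delete_edge u v G)"
| edge_contraction: "(u,v) \<in> parcs G \<Longrightarrow> minor_step G (contract_edge u v G)"

text \<open>\<open>K\<^bsub>4\<^esub> H\<close> says that \<open>H\<close> is a complete graph on 4 vertices, not that it is a fixed copy of one.\<close>

definition K4_minor_free :: "'a pair_pre_digraph \<Rightarrow> bool" where
  "K4_minor_free G \<longleftrightarrow> \<not> (\<exists>H. minor_step\<^sup>*\<^sup>* G H \<and> K\<^bsub>4\<^esub> (with_proj H))"

lemma pair_graph_minor_step: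
  assumes "minor_step G H" and "pair_graph G"
  shows "pair_graph H"
  using assms
proof cases
  interpret pair_graph G by fact
  have sym: "(b,a) \<in> parcs G" if "(a,b) \<in> parcs G" for a b
    using that pair_sym_arcs by (auto simp: symmetric_def dest: symD)
  have vs: "a \<in> pverts G" "b \<in> pverts G" "a \<noteq> b" if "(a,b) \<in> parcs G" for a b
    using in_arcsD1[OF that] in_arcsD2[OF that] pair_no_loops[OF that] by simp_all
  have graphI: "pair_graph K"
    if "finite (pverts K)" "sym (parcs K)"
      and "\<And>a b. (a,b) \<in> parcs K \<Longrightarrow> a \<in> pverts K \<and> b \<in> pverts K \<and> a \<noteq> b" for K :: "'a pair_pre_digraph"
  proof -
    have "parcs K \<subseteq> pverts K \<times> pverts K" using that by auto
    then have "finite (parcs K)" using that by (meson finite_SigmaI finite_subset)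
    then show ?thesis
      using that by unfold_locales (auto simp: symmetric_def)
  qed
  {
    case (vertex_deletion v)
    then show ?thesis
      by (intro graphI) (auto simp: delete_vertex_def sym_def pair_finite_verts dest: sym vs)
  next
    case (edge_deletion u v)
    then show ?thesis
      by (intro graphI) (auto simp: delete_edge_def sym_def pair_finite_verts dest: sym vs)
  next
    case (edge_contraction u v)
    show ?thesis
      unfolding edge_contraction(1)
    proof (rule graphI)
      show "finite (pverts (contract_edge u v G))"
        by (simp add: contract_edge_def pair_finite_verts)
      show "sym (parcs (contract_edge u v G))"
        unfolding contract_edge_def sym_def using sym by simp metis
      show "a \<in> pverts (contract_edge u v G) \<and> b \<in> pverts (contract_edge u v G) \<and> a \<noteq> b"
        if "(a,b) \<in> parcs (contract_edge u v G)" for a b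
      proof -
        have "merge u v w \<in> pverts G - {v}" if "w \<in> pverts G" for w
          using that vs[OF edge_contraction(2)] by (simp add: merge_def)
        with that vs show ?thesis by (fastforce simp: contract_edge_def)
      qed
    qed
  }
qed

end

theory Submission
  imports Defs
begin

text \<open>
  Root the tree at \<open>x\<close> and put \<open>g = f - 1\<close>: then every vertex \<open>u\<close> may have at most \<open>g u\<close> children. The
  induction removes a vertex \<open>v \<noteq> x\<close> of degree 1 or 2, which exists in every connected
  \<open>K\<^sub>4\<close>-minor-free graph with at least two vertices.
  To keep the toughness condition exact, edges carry weights: the weight \<open>w(ab)\<close> counts vertices that
  hung between \<open>a\<close> and \<open>b\<close>, the condition becomes \<open>c(G - S) + w(G[S]) \<le> g(S)\<close>, and each unit of \<open>w(ab)\<close>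
  has to be paid by the budget of \<open>a\<close> or of \<open>b\<close>. A unit paid by \<open>a\<close> also buys the tree edge from \<open>a\<close> to
  its child \<open>b\<close>. Suppose that \<open>v\<close> has neighbours \<open>a\<close>, \<open>b\<close> and put \<open>p = w(va)\<close>, \<open>q = w(vb)\<close>. Then \<open>a\<close> certainly
  pays \<open>max 0 (p - g v)\<close>, \<open>b\<close> pays \<open>max 0 (q - g v)\<close>, and \<open>a\<close>, \<open>b\<close> together pay \<open>max 1 (p + q - g v)\<close>: the
  first two amounts are deducted from the budgets, and what is missing to the third one is added to
  the weight of \<open>ab\<close>. This loses nothing in either direction.
\<close>

section \<open>Vertices of degree at most two\<close>

lemma K4_minor_free_minor_step:
  "K4_minor_free G \<Longrightarrow> minor_step G H \<Longrightarrow> K4_minor_free H"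
  unfolding K4_minor_free_def by (blast intro: converse_rtranclp_into_rtranclp)

lemma (in pair_graph) arcs_sym: "(u,v) \<in> parcs G \<Longrightarrow> (v,u) \<in> parcs G"
  using pair_sym_arcs by (auto simp: symmetric_def dest: symD)

lemma (in pair_graph) finite_neighbours [simp]: "finite (parcs G `` A)"
  using pair_finite_verts in_arcsD2 by (auto intro: finite_subset)

text \<open>The vertices outside \<open>A\<close> can be deleted one at a time. Once none is left,
  simplicity makes the remaining graph complete on 4 vertices.\<close>

lemma not_K4_minor_free_clique:
  assumes "pair_graph G" "A \<subseteq> pverts G" "card A = 4"
    and "\<And>u v. u \<in> A \<Longrightarrow> v \<in> A \<Longrightarrow> u \<noteq> v \<Longrightarrow> (u,v) \<in> parcs G"
  shows "\<not> K4_minor_free G"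
  using assms
proof (induction "card (pverts G - A)" arbitrary: G)
  case 0
  interpret pair_graph G by fact
  have "pverts G = A" using 0 pair_finite_verts by auto
  moreover have "parcs G = {(u,v). (u,v) \<in> pverts G \<times> pverts G \<and> u \<noteq> v}"
    unfolding \<open>pverts G = A\<close>
    by (auto intro: 0(5) dest: in_arcsD1 in_arcsD2 no_loops' simp flip: \<open>pverts G = A\<close>)
  ultimately have "K\<^bsub>4\<^esub> (with_proj G)"
    using 0 pair_finite_verts by (simp add: complete_digraph_pair_def)
  then show ?case by (auto simp: K4_minor_free_def)
next
  case (Suc n)
  interpret pair_graph G by fact
  obtain v where v: "v \<in> pverts G" "v \<notin> A" using Suc(2) by (metis DiffE all_not_in_conv card.empty nat.distinct(1))
  have step: "minor_step G (delete_vertex v G)" using v by (intro vertex_deletion)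
  have "n = card (pverts G - A - {v})"
    using Suc(2) v pair_finite_verts by simp
  also have "pverts G - A - {v} = pverts (delete_vertex v G) - A"
    by (auto simp: delete_vertex_def)
  finally have "\<not> K4_minor_free (delete_vertex v G)"
    using Suc v by (intro Suc(1) pair_graph_minor_step[OF step]) (auto simp: delete_vertex_def)
  then show ?case using K4_minor_free_minor_step step by blast
qed

lemma (in pair_graph) neighbours_contract_edge:
  assumes "t \<noteq> a" "t \<noteq> v"
  shows "parcs (contract_edge a v G) `` {t} = merge a v ` (parcs G `` {t})"
proof -
  have merge_t: "merge a v s = t \<longleftrightarrow> s = t" for s
    using assms by (auto simp: merge_def)
  have "parcs (contract_edge a v G) `` {t} =
      {merge a v s | s. (t,s) \<in> parcs G \<and> merge a v s \<noteq> t}"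
    unfolding set_eq_iff by (simp add: contract_edge_def) (metis merge_t)
  also have "\<dots> = merge a v ` (parcs G `` {t})"
    using no_loops' by (auto simp: merge_t)
  finally show ?thesis .
qed

text \<open>\<open>merge a v\<close> identifies two neighbours of \<open>t\<close> only if both
  \<open>a\<close> and \<open>v\<close> are among them, and then the degree drops by one. The last
  assumption excludes the only case in which this leads from 3 to 2.\<close>

lemma (in pair_graph) card_neighbours_contract_edge:
  assumes "t \<noteq> a" "t \<noteq> v" "3 \<le> card (parcs G `` {t})"
    and "(t,a) \<in> parcs G \<Longrightarrow> (t,v) \<in> parcs G \<Longrightarrow> card (parcs G `` {t}) \<noteq> 3"
  shows "3 \<le> card (parcs (contract_edge a v G) `` {t})"
proof (cases "(t,v) \<in> parcs G \<and> (t,a) \<in> parcs G")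
  case True
  have "parcs G `` {t} - {v} = merge a v ` (parcs G `` {t} - {v})" by (auto simp: merge_def)
  also have "\<dots> \<subseteq> merge a v ` (parcs G `` {t})" by auto
  finally have "card (parcs G `` {t} - {v}) \<le> card (merge a v ` (parcs G `` {t}))"
    by (intro card_mono) auto
  moreover have "card (parcs G `` {t} - {v}) = card (parcs G `` {t}) - 1"
    using True by (simp add: card_Diff_singleton)
  ultimately show ?thesis using True assms by (simp add: neighbours_contract_edge)
next
  case False
  then have "inj_on (merge a v) (parcs G `` {t})"
    by (auto simp: inj_on_def merge_def)
  then show ?thesis using assms by (simp add: neighbours_contract_edge card_image)
qed

lemma three_neighbours_avoid:
  assumes "3 \<le> card (R `` {t})"
  obtains s where "(t,s) \<in> R" "s \<noteq> p" "s \<noteq> q"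
proof -
  have "\<not> R `` {t} \<subseteq> {p,q}"
  proof
    assume "R `` {t} \<subseteq> {p,q}"
    then have "card (R `` {t}) \<le> card {p,q}" by (intro card_mono) auto
    also have "\<dots> \<le> 2" by (simp add: card_insert_if)
    finally show False using assms by simp
  qed
  with that show thesis by auto
qed

text \<open>
  Contracting an edge \<open>av\<close> lowers the degree only of common neighbours of \<open>a\<close> and \<open>v\<close>. If some
  common neighbour \<open>z\<close> of \<open>x\<close> and \<open>y\<close> has degree 3, then its third neighbour \<open>u\<close> completes a \<open>K\<^sub>4\<close> or
  \<open>z\<close> can be contracted into \<open>x\<close> or \<open>y\<close>. Otherwise \<open>y\<close> can be contracted into \<open>x\<close>.
\<close>

lemma not_K4_minor_free_two_exceptions:
  assumes "pair_graph G" "(x,y) \<in> parcs G" "z \<in> pverts G" "z \<noteq> x" "z \<noteq> y"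
    and "\<And>v. v \<in> pverts G \<Longrightarrow> v \<noteq> x \<Longrightarrow> v \<noteq> y \<Longrightarrow> 3 \<le> card (parcs G `` {v})"
  shows "\<not> K4_minor_free G"
  using assms
proof (induction "card (pverts G)" arbitrary: G x y z rule: less_induct)
  case less
  interpret pair_graph G by (rule less.prems)
  note deg = less.prems(6)
  have x: "x \<in> pverts G" and y: "y \<in> pverts G" and xy: "x \<noteq> y"
    using less.prems(2) in_arcsD1 in_arcsD2 no_loops' by auto
  have smaller: "card (pverts (contract_edge a v G)) < card (pverts G)" if "(a,v) \<in> parcs G" for a v
    using card_Diff1_less[OF pair_finite_verts in_arcsD2[OF that]] by (simp add: contract_edge_def)
  have step: "minor_step G (contract_edge a v G)" if "(a,v) \<in> parcs G" for a v
    using that by (rule minor_step.edge_contraction)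
  have graph: "pair_graph (contract_edge a v G)" if "(a,v) \<in> parcs G" for a v
    using step[OF that] less.prems(1) by (rule pair_graph_minor_step)
  \<comment> \<open>Contracting \<open>z\<close> into \<open>x\<close> keeps \<open>x\<close>,
    \<open>y\<close> as the exceptional pair, and \<open>u\<close> takes over the role of
    \<open>z\<close>. The variables are local, so that the claim also applies with \<open>x\<close>
    and \<open>y\<close> exchanged.\<close>
  have absorb: "\<not> K4_minor_free G"
    if xy': "(x,y) \<in> parcs G" "\<And>v. v \<in> pverts G \<Longrightarrow> v \<noteq> x \<Longrightarrow> v \<noteq> y \<Longrightarrow> 3 \<le> card (parcs G `` {v})"
      and z: "(x,z) \<in> parcs G" "parcs G `` {z} = {x,y,u}" "z \<noteq> y"
      and u: "u \<noteq> x" "u \<noteq> y" "(x,u) \<notin> parcs G"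
    for x y z u
  proof -
    have "u \<noteq> z" "z \<noteq> x" "u \<in> pverts G" "x \<noteq> y" using z(1,2) xy' in_arcsD2 no_loops' by blast+
    have "\<not> K4_minor_free (contract_edge x z G)"
    proof (rule less.hyps[OF smaller])
      show "(x,z) \<in> parcs G" "pair_graph (contract_edge x z G)" using z graph by auto
      show "(x,y) \<in> parcs (contract_edge x z G)"
        using xy' \<open>z \<noteq> x\<close> z(3) \<open>x \<noteq> y\<close> unfolding contract_edge_def merge_def by force
      show "u \<in> pverts (contract_edge x z G)"
        using \<open>u \<noteq> z\<close> \<open>u \<in> pverts G\<close> by (simp add: contract_edge_def)
      fix v assume v: "v \<in> pverts (contract_edge x z G)" "v \<noteq> x" "v \<noteq> y"
      then have "v \<in> pverts G" "v \<noteq> z" by (auto simp: contract_edge_def)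
      \<comment> \<open>A common neighbour of \<open>x\<close> and \<open>z\<close> other than
        \<open>y\<close> can only be \<open>u\<close>, which is not adjacent to
        \<open>x\<close>.\<close>
      moreover have False if "(v,x) \<in> parcs G" "(v,z) \<in> parcs G"
      proof -
        have "v \<in> parcs G `` {z}" using that arcs_sym by auto
        then have "v = u" using v z(2) by auto
        then show False using that u arcs_sym by auto
      qed
      ultimately show "3 \<le> card (parcs (contract_edge x z G) `` {v})"
        using v xy'(2) by (intro card_neighbours_contract_edge) auto
    qed (use u in auto)
    then show ?thesis using K4_minor_free_minor_step[OF _ step[OF z(1)]] by blast
  qed
  show ?case
  proof (cases "\<exists>z. (x,z) \<in> parcs G \<and> (y,z) \<in> parcs G \<and> card (parcs G `` {z}) = 3")
    case True
    then obtain z where z: "(x,z) \<in> parcs G" "(y,z) \<in> parcs G" "card (parcs G `` {z}) = 3" by blast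
    then obtain u where u: "(z,u) \<in> parcs G" "u \<noteq> x" "u \<noteq> y"
      by (auto intro: three_neighbours_avoid[of "parcs G" z x y])
    have "z \<noteq> x" "z \<noteq> y" "z \<noteq> u" using z u no_loops' by auto
    have nz: "parcs G `` {z} = {x,y,u}"
      using z u xy by (intro card_subset_eq[symmetric]) (auto intro: arcs_sym)
    consider "(x,u) \<notin> parcs G" | "(y,u) \<notin> parcs G" | "(x,u) \<in> parcs G" "(y,u) \<in> parcs G" by blast
    then show ?thesis
    proof cases
      case 1
      then show ?thesis using absorb[of x y z u] less.prems z nz u \<open>z \<noteq> y\<close> by blast
    next
      case 2
      have "parcs G `` {z} = {y,x,u}" using nz by auto
      then show ?thesis using 2 absorb[of y x z u] less.prems z u \<open>z \<noteq> x\<close> arcs_sym by blast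
    next
      case 3
      show ?thesis
      proof (rule not_K4_minor_free_clique)
        show "{x,y,z,u} \<subseteq> pverts G" using x y z u in_arcsD2 by auto
        show "card {x,y,z,u} = 4" using \<open>z \<noteq> x\<close> \<open>z \<noteq> y\<close> \<open>z \<noteq> u\<close> u xy by simp
      qed (use 3 z u less.prems arcs_sym in auto)
    qed
  next
    case False
    let ?H = "contract_edge x y G"
    interpret H: pair_graph ?H using less.prems(2) by (rule graph)
    have degH: "3 \<le> card (parcs ?H `` {v})" if "v \<in> pverts ?H" "v \<noteq> x" for v
      using that False arcs_sym deg
      by (intro card_neighbours_contract_edge) (auto simp: contract_edge_def)
    have zH: "z \<in> pverts ?H" using less.prems by (simp add: contract_edge_def)
    \<comment> \<open>Only the merged vertex \<open>x\<close> may have degree below 3 in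
      \<open>?H\<close>. Any neighbour \<open>y'\<close> makes it part of an exceptional edge; if it
      is isolated, it is deleted and any edge of the rest will do.\<close>
    have "\<not> K4_minor_free ?H"
    proof (cases "\<exists>y'. (x,y') \<in> parcs ?H")
      case True
      then obtain y' where y': "(x,y') \<in> parcs ?H" by blast
      then have "y' \<in> pverts ?H" "y' \<noteq> x" using H.in_arcsD2 H.no_loops' by auto
      from degH[OF this] obtain t where "(y',t) \<in> parcs ?H" "t \<noteq> x" by (rule three_neighbours_avoid)
      then show ?thesis
        using y' H.in_arcsD2 H.no_loops' degH smaller[OF less.prems(2)] H.pair_graph_axioms
        by (intro less.hyps[of ?H x y' t]) auto
    next
      case no_nbr: False
      let ?K = "delete_vertex x ?H"
      have x': "x \<in> pverts ?H" using x xy by (simp add: contract_edge_def)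
      then have stepK: "minor_step ?H ?K" by (rule minor_step.vertex_deletion)
      then interpret K: pair_graph ?K using H.pair_graph_axioms by (rule pair_graph_minor_step)
      have nbK: "parcs ?K `` {v} = parcs ?H `` {v}" if "v \<noteq> x" for v
        using that no_nbr H.arcs_sym by (auto simp: delete_vertex_def)
      have degK: "3 \<le> card (parcs ?K `` {v})" if "v \<in> pverts ?K" for v
        using that degH nbK by (auto simp: delete_vertex_def)
      have zK: "z \<in> pverts ?K" using zH less.prems by (simp add: delete_vertex_def)
      from degK[OF zK] obtain w where w: "(z,w) \<in> parcs ?K" by (rule three_neighbours_avoid)
      from degK[OF zK] obtain t where t: "(z,t) \<in> parcs ?K" "t \<noteq> w" by (rule three_neighbours_avoid)
      have "card (pverts ?K) \<le> card (pverts ?H)"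
        using H.pair_finite_verts by (auto simp: delete_vertex_def intro: card_mono)
      then have "\<not> K4_minor_free ?K"
        using t w K.in_arcsD2 K.no_loops' degK smaller[OF less.prems(2)] K.pair_graph_axioms
        by (intro less.hyps[of ?K z w t]) auto
      then show ?thesis using K4_minor_free_minor_step[OF _ stepK] by blast
    qed
    then show ?thesis using K4_minor_free_minor_step[OF _ step[OF less.prems(2)]] by blast
  qed
qed

text \<open>The vertex must differ from \<open>x\<close>, which will be the root. If all other
  vertices had degree at least 3, then \<open>x\<close>, \<open>y\<close> would form an exceptional
  edge, with another neighbour of \<open>y\<close> as the further vertex.\<close>

lemma K4_minor_free_low_degree:
  assumes "pair_graph G" "K4_minor_free G" "(x,y) \<in> parcs G"
  shows "\<exists>v\<in>pverts G. v \<noteq> x \<and> card (parcs G `` {v}) \<le> 2"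
proof (rule ccontr)
  assume *: "\<not> ?thesis"
  interpret pair_graph G by fact
  have deg: "3 \<le> card (parcs G `` {v})" if "v \<in> pverts G" "v \<noteq> x" for v
    using that * by force
  have "y \<in> pverts G" "y \<noteq> x" using assms(3) in_arcsD2 no_loops' by auto
  from deg[OF this] obtain z where "(y,z) \<in> parcs G" "z \<noteq> x" by (rule three_neighbours_avoid)
  moreover have "y \<noteq> z" using \<open>(y,z) \<in> parcs G\<close> by (rule no_loops')
  ultimately have "\<not> K4_minor_free G"
    using assms deg in_arcsD2 by (intro not_K4_minor_free_two_exceptions[of G x y z]) auto
  then show False using assms by blast
qed

section \<open>Components and contraction\<close>

text \<open>\<open>rtrancl_on U E\<close> admits walks inside \<open>U\<close> only. With
  \<open>E\<close> and \<open>U\<close> kept apart, deleting vertices shrinks \<open>U\<close> and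
  leaves \<open>E\<close> alone.\<close>

definition components :: "'a rel \<Rightarrow> 'a set \<Rightarrow> 'a set set" where
  "components E U = (\<lambda>u. rtrancl_on U E `` {u}) ` U"

text \<open>The arcs are symmetric, so a strong component consists of all vertices reachable from
  any one of its members.\<close>

lemma num_components_minus_verts:
  assumes "pair_graph G"
  shows "num_components (minus_verts G S) = card (components (parcs G) (pverts G - S))"
proof -
  interpret pair_graph G by fact
  let ?H = "minus_verts G S"
  interpret H: wf_digraph ?H by (rule wellformed_induce_subgraph)
  have ends: "arcs_ends ?H = {(u,v) \<in> parcs G. u \<in> pverts G - S \<and> v \<in> pverts G - S}"
    by (auto simp: arcs_ends_def arc_to_ends_def image_iff)
  have reach: "u \<rightarrow>\<^sup>*\<^bsub>?H\<^esub> v \<longleftrightarrow> (u,v) \<in> rtrancl_on (pverts G - S) (parcs G)" for u v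
  proof
    assume "(u,v) \<in> rtrancl_on (pverts G - S) (parcs G)"
    then show "u \<rightarrow>\<^sup>*\<^bsub>?H\<^esub> v"
      unfolding reachable_def
      by (induct rule: rtrancl_on_induct) (auto simp: ends intro: rtrancl_on_into_rtrancl_on)
  qed (auto simp: reachable_def ends intro: rtrancl_on_mono[rotated 2])
  have "sym (rtrancl_on (pverts G - S) (parcs G))"
    by (rule rtrancl_on_sym) (rule symI, rule arcs_sym)
  then have "H.scc_of u = rtrancl_on (pverts G - S) (parcs G) `` {u}" for u
    by (auto simp: H.scc_of_def reach dest: symD)
  then have "H.sccs_verts = components (parcs G) (pverts G - S)"
    by (simp add: H.sccs_verts_conv_scc_of components_def)
  then show ?thesis
    using H.card_sccs_verts by (simp add: num_components_def)
qed

lemma rtrancl_on_class_eq: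
  assumes "sym E" "(u,v) \<in> rtrancl_on U E"
  shows "rtrancl_on U E `` {u} = rtrancl_on U E `` {v}"
  using symD[OF rtrancl_on_sym[OF assms(1)] assms(2)] assms(2) by (auto intro: rtrancl_on_trans)

text \<open>\<open>r\<close> carries walks to walks, so it maps each component in \<open>U\<close>
  into a single component in \<open>W\<close>; every component in \<open>W\<close> is met because
  \<open>r\<close> is onto.\<close>

lemma card_components_le_hom:
  assumes "finite U" "sym E" "sym F" "W = r ` U"
    and hom: "\<And>s t. (s,t) \<in> E \<Longrightarrow> s \<in> U \<Longrightarrow> t \<in> U \<Longrightarrow> r s = r t \<or> (r s, r t) \<in> F"
  shows "card (components F W) \<le> card (components E U)"
proof -
  have reach: "(r s, r t) \<in> rtrancl_on W F" if "(s,t) \<in> rtrancl_on U E" for s t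
    using that
  proof (induct rule: rtrancl_on_induct)
    case base
    then show ?case using assms(4) by simp
  next
    case (step y z)
    then show ?case using hom[of y z] assms(4) by (auto intro: rtrancl_on_into_rtrancl_on)
  qed
  \<comment> \<open>All sets in the union coincide. The union makes the class depend on the
    component of \<open>u\<close> only, not on the representative.\<close>
  have "rtrancl_on W F `` {r u} = (\<Union>t \<in> rtrancl_on U E `` {u}. rtrancl_on W F `` {r t})"
    if "u \<in> U" for u
  proof -
    have "rtrancl_on W F `` {r t} = rtrancl_on W F `` {r u}" if "(u,t) \<in> rtrancl_on U E" for t
      using rtrancl_on_class_eq[OF assms(3) reach[OF that]] by simp
    moreover have "(u,u) \<in> rtrancl_on U E" using that by simp
    ultimately show ?thesis by blast
  qed
  then have "components F W \<subseteq> (\<lambda>C. \<Union>t\<in>C. rtrancl_on W F `` {r t}) ` components E U"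
    unfolding components_def assms(4) by (auto simp: image_iff)
  then show ?thesis
    using assms(1) by (intro surj_card_le) (auto simp: components_def)
qed

lemma card_components_isolated:
  assumes "finite U" "v \<notin> U" "\<And>u. u \<in> insert v U \<Longrightarrow> (v,u) \<notin> E \<and> (u,v) \<notin> E"
  shows "card (components E (insert v U)) = card (components E U) + 1"
proof -
  have eq: "(u,t) \<in> rtrancl_on U E" if "(u,t) \<in> rtrancl_on (insert v U) E" "u \<noteq> v" for u t
    using that(1)
  proof (induct rule: rtrancl_on_induct)
    case base
    then show ?case using that by simp
  next
    case (step y z)
    then have "z \<noteq> v" "z \<in> U" using assms(3) by auto
    then show ?case using step by (auto intro: rtrancl_on_into_rtrancl_on)
  qed
  have v: "t = v" if "(v,t) \<in> rtrancl_on (insert v U) E" for t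
    using that by (induct rule: rtrancl_on_induct) (use assms(3) in auto)
  have "rtrancl_on (insert v U) E `` {v} = {v}" using v by auto
  moreover have "rtrancl_on (insert v U) E `` {u} = rtrancl_on U E `` {u}" if "u \<in> U" for u
    using that assms(2) eq by (auto intro: rtrancl_on_mono[of E E U "insert v U"])
  ultimately have "components E (insert v U) = insert {v} (components E U)"
    unfolding components_def by auto
  moreover have "{v} \<notin> components E U"
    using assms(2) by (auto simp: components_def dest: in_rtrancl_on_in_F)
  ultimately show ?thesis using assms(1) by (simp add: components_def)
qed

lemma components_cong:
  assumes "\<And>u v. u \<in> U \<Longrightarrow> v \<in> U \<Longrightarrow> (u,v) \<in> E \<longleftrightarrow> (u,v) \<in> F"
  shows "components E U = components F U"
proof -
  have "rtrancl_on U E \<subseteq> rtrancl_on U F" if "\<And>u v. u \<in> U \<Longrightarrow> v \<in> U \<Longrightarrow> (u,v) \<in> E \<longleftrightarrow> (u,v) \<in> F" for E F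
  proof (rule subrelI)
    fix u v assume "(u,v) \<in> rtrancl_on U E"
    then show "(u,v) \<in> rtrancl_on U F"
      by (induct rule: rtrancl_on_induct) (auto simp: that intro: rtrancl_on_into_rtrancl_on)
  qed
  then have "rtrancl_on U E = rtrancl_on U F" using assms by (intro equalityI) auto
  then show ?thesis by (simp add: components_def)
qed

lemma (in pair_graph) sym_parcs: "sym (parcs G)"
  by (rule symI, rule arcs_sym)

lemma (in pair_graph) arc_ends:
  assumes "(u,v) \<in> parcs G"
  shows "u \<in> pverts G" "v \<in> pverts G" "u \<noteq> v"
  using in_arcsD1[OF assms] in_arcsD2[OF assms] no_loops'[OF assms] .

text \<open>\<open>v\<close> gives way to an edge between its neighbours. Degree 1 is included as
  \<open>a = b\<close>; then \<open>- Id\<close> drops the loop.\<close>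

lemma (in pair_graph) parcs_contract_edge:
  assumes "parcs G `` {v} = {a,b}"
  shows "parcs (contract_edge a v G) =
    {(s,t) \<in> parcs G. s \<noteq> v \<and> t \<noteq> v} \<union> ({(a,b),(b,a)} - Id)"
proof -
  have nv: "(v,t) \<in> parcs G \<longleftrightarrow> t = a \<or> t = b" for t using assms by auto
  have nv': "(t,v) \<in> parcs G \<longleftrightarrow> t = a \<or> t = b" for t using nv arcs_sym by blast
  have "a \<noteq> v" "b \<noteq> v" using nv no_loops' by blast+
  show ?thesis
  proof (intro equalityI subrelI)
    fix s t assume "(s,t) \<in> parcs (contract_edge a v G)"
    then obtain s' t' where "(s',t') \<in> parcs G" "s = merge a v s'" "t = merge a v t'" "s \<noteq> t"
      by (auto simp: contract_edge_def)
    then show "(s,t) \<in> {(s,t) \<in> parcs G. s \<noteq> v \<and> t \<noteq> v} \<union> ({(a,b),(b,a)} - Id)"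
      using nv nv' by (auto simp: merge_def split: if_splits)
  next
    fix s t assume st: "(s,t) \<in> {(s,t) \<in> parcs G. s \<noteq> v \<and> t \<noteq> v} \<union> ({(a,b),(b,a)} - Id)"
    have "s \<noteq> t" using st no_loops'[of s t] by auto
    have "\<exists>s' t'. (s',t') \<in> parcs G \<and> merge a v s' = s \<and> merge a v t' = t"
    proof (cases "(s,t) \<in> parcs G \<and> s \<noteq> v \<and> t \<noteq> v")
      case True
      then show ?thesis by (intro exI[of _ s] exI[of _ t]) (simp add: merge_def)
    next
      case False
      \<comment> \<open>The new edge is the image of the edge \<open>vb\<close>, as \<open>v\<close>
        is merged into \<open>a\<close>.\<close>
      then consider "s = a" "t = b" | "s = b" "t = a" using st by auto
      then show ?thesis
      proof cases
        case 1
        then show ?thesis using nv \<open>b \<noteq> v\<close> by (intro exI[of _ v] exI[of _ b]) (simp add: merge_def)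
      next
        case 2
        then show ?thesis using nv' \<open>b \<noteq> v\<close> by (intro exI[of _ b] exI[of _ v]) (simp add: merge_def)
      qed
    qed
    then show "(s,t) \<in> parcs (contract_edge a v G)"
      using \<open>s \<noteq> t\<close> by (auto simp: contract_edge_def)
  qed
qed

text \<open>The preceding description of the arcs is symmetric in \<open>a\<close> and
  \<open>b\<close>.\<close>

lemma (in pair_graph) contract_edge_commute:
  assumes "parcs G `` {v} = {a,b}"
  shows "contract_edge b v G = contract_edge a v G"
proof -
  have "parcs (contract_edge b v G) = parcs (contract_edge a v G)"
    using assms parcs_contract_edge[of v a b] parcs_contract_edge[of v b a] by (auto simp: insert_commute)
  then show ?thesis by (simp add: contract_edge_def)
qed

text \<open>\<open>merge\<close> is a homomorphism onto the contracted graph without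
  \<open>S\<close>, provided that the neighbour absorbing \<open>v\<close> is not in
  \<open>S\<close>. Either neighbour may be chosen for this.\<close>

lemma (in pair_graph) components_contract_edge_le:
  assumes v: "parcs G `` {v} = {a,b}" and S: "\<not> {a,b} \<subseteq> S" "v \<notin> S"
  shows "card (components (parcs (contract_edge a v G)) (pverts G - {v} - S))
    \<le> card (components (parcs G) (pverts G - S))"
proof -
  have *: "card (components (parcs (contract_edge a v G)) (pverts G - {v} - S))
      \<le> card (components (parcs G) (pverts G - S))"
    if v: "(v,a) \<in> parcs G" and a: "a \<notin> S" for a
  proof (rule card_components_le_hom)
    interpret H: pair_graph "contract_edge a v G"
      by (rule pair_graph_minor_step[OF minor_step.edge_contraction pair_graph_axioms])
        (rule arcs_sym[OF v])
    have "v \<in> pverts G" "a \<in> pverts G" "v \<noteq> a" using v in_arcsD1 in_arcsD2 no_loops' by auto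
    then show "pverts G - {v} - S = merge a v ` (pverts G - S)"
      using a S(2) by (auto simp: merge_def image_iff)
    show "sym (parcs (contract_edge a v G))" by (rule H.sym_parcs)
    fix s t assume "(s,t) \<in> parcs G"
    then show "merge a v s = merge a v t \<or> (merge a v s, merge a v t) \<in> parcs (contract_edge a v G)"
      by (auto simp: contract_edge_def)
  qed (simp_all add: pair_finite_verts sym_parcs)
  show ?thesis
  proof (cases "a \<in> S")
    case True
    then have "b \<notin> S" using S by auto
    then show ?thesis using *[of b] v contract_edge_commute[OF v] by auto
  next
    case False
    then show ?thesis using *[of a] v by auto
  qed
qed

text \<open>Contracting into \<open>a\<close> and deleting \<open>v\<close> can differ only in the
  edge \<open>ab\<close>, which disappears together with its end in \<open>S\<close>.\<close>

lemma (in pair_graph) components_contract_edge_eq: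
  assumes v: "parcs G `` {v} = {a,b}" and S: "a \<in> S \<or> b \<in> S"
  shows "components (parcs (contract_edge a v G)) (pverts G - {v} - S)
    = components (parcs G) (pverts G - insert v S)"
proof -
  have "pverts G - {v} - S = pverts G - insert v S" by auto
  then show ?thesis using S by (auto simp: parcs_contract_edge[OF v] intro!: components_cong)
qed

text \<open>Once all its neighbours are deleted, \<open>v\<close> is a component of its own.\<close>

lemma (in pair_graph) components_isolated:
  assumes v: "parcs G `` {v} \<subseteq> S" "v \<in> pverts G" "v \<notin> S"
  shows "card (components (parcs G) (pverts G - S))
    = card (components (parcs G) (pverts G - insert v S)) + 1"
proof -
  have eq: "pverts G - S = insert v (pverts G - insert v S)" using v by auto
  have "(v,u) \<notin> parcs G \<and> (u,v) \<notin> parcs G" if "u \<in> insert v (pverts G - insert v S)" for u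
    using that v arcs_sym[of u v] no_loops'[of v v] by auto
  then show ?thesis
    unfolding eq by (intro card_components_isolated) (simp_all add: pair_finite_verts)
qed

lemma (in pair_graph) neighbour_exists:
  assumes "card (components (parcs G) (pverts G)) \<le> 1" "v \<in> pverts G" "pverts G \<noteq> {v}"
  shows "\<exists>u. (v,u) \<in> parcs G"
proof (rule ccontr)
  assume "\<not> ?thesis"
  then have "card (components (parcs G) (pverts G)) = card (components (parcs G) (pverts G - {v})) + 1"
    using components_isolated[of v "{}"] assms by auto
  moreover have "components (parcs G) (pverts G - {v}) \<noteq> {}"
    using assms by (auto simp: components_def)
  then have "0 < card (components (parcs G) (pverts G - {v}))"
    using pair_finite_verts by (simp add: card_gt_0_iff components_def)
  ultimately show False using assms by simp
qed

section \<open>Weighted toughness and paid trees\<close>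

text \<open>
  A weight \<open>w u v\<close> on an edge \<open>uv\<close> stands for \<open>w u v\<close> components that become separated when
  \<open>u\<close> and \<open>v\<close> are removed. The double sum counts every edge inside \<open>S\<close> twice.
\<close>

definition edge_weight :: "'a pair_pre_digraph \<Rightarrow> ('a \<Rightarrow> 'a \<Rightarrow> int) \<Rightarrow> bool" where
  "edge_weight G w \<longleftrightarrow>
    (\<forall>u v. 0 \<le> w u v \<and> w u v = w v u \<and> ((u,v) \<notin> parcs G \<longrightarrow> w u v = 0))"

definition weighted_tough :: "'a pair_pre_digraph \<Rightarrow> ('a \<Rightarrow> 'a \<Rightarrow> int) \<Rightarrow> ('a \<Rightarrow> int) \<Rightarrow> bool" where
  "weighted_tough G w g \<longleftrightarrow>
    (\<forall>S. S \<subseteq> pverts G \<longrightarrow> S \<noteq> {} \<longrightarrow>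
      2 * int (card (components (parcs G) (pverts G - S))) + (\<Sum>u\<in>S. \<Sum>v\<in>S. w u v) \<le> 2 * (\<Sum>u\<in>S. g u))"

text \<open>
  A tree rooted at \<open>x\<close> is given by its parent function \<open>\<pi>\<close>, and \<open>d\<close> witnesses that it has no
  cycles. The two ends of each edge share its weight: \<open>u\<close> pays \<open>m u v\<close> towards the edge \<open>uv\<close>, at
  least 1 if \<open>u\<close> is the parent of \<open>v\<close>, and the budget of \<open>u\<close> is \<open>g u\<close>.
\<close>

definition paid_tree ::
  "'a pair_pre_digraph \<Rightarrow> ('a \<Rightarrow> 'a \<Rightarrow> int) \<Rightarrow> ('a \<Rightarrow> int) \<Rightarrow> 'a \<Rightarrow>
    ('a \<Rightarrow> 'a) \<Rightarrow> ('a \<Rightarrow> nat) \<Rightarrow> ('a \<Rightarrow> 'a \<Rightarrow> int) \<Rightarrow> bool" where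
  "paid_tree G w g x \<pi> d m \<longleftrightarrow>
    (\<forall>u\<in>pverts G - {x}. (\<pi> u, u) \<in> parcs G \<and> d (\<pi> u) < d u \<and> 1 \<le> m (\<pi> u) u) \<and>
    (\<forall>u v. 0 \<le> m u v) \<and>
    (\<forall>u v. (u,v) \<in> parcs G \<longrightarrow> w u v \<le> m u v + m v u) \<and>
    (\<forall>u\<in>pverts G. (\<Sum>v\<in>pverts G. m u v) \<le> g u)"

text \<open>Each edge from \<open>v\<close> into \<open>S\<close> occurs in the double sum in both
  orders, and \<open>w v v\<close> vanishes for lack of loops.\<close>

lemma sum_weight_insert:
  assumes "edge_weight G w" "pair_graph G" "finite S" "v \<notin> S"
  shows "(\<Sum>s\<in>insert v S. \<Sum>t\<in>insert v S. w s t) = (\<Sum>s\<in>S. \<Sum>t\<in>S. w s t) + 2 * (\<Sum>t\<in>S. w v t)"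
proof -
  interpret pair_graph G by fact
  have "w v v = 0" using assms(1) no_loops' unfolding edge_weight_def by blast
  moreover have "(\<Sum>s\<in>S. w s v) = (\<Sum>s\<in>S. w v s)"
    using assms(1) unfolding edge_weight_def by (intro sum.cong refl) blast
  ultimately show ?thesis using assms(3,4) by (simp add: sum.distrib)
qed

lemma sum_weight_neighbours:
  assumes "edge_weight G w" "finite S" "parcs G `` {v} \<subseteq> N"
  shows "(\<Sum>t\<in>S. w v t) = (\<Sum>t\<in>S \<inter> N. w v t)"
proof (rule sum.mono_neutral_right)
  have "w v t = 0" if "t \<notin> N" for t
    using assms(1,3) that unfolding edge_weight_def by blast
  then show "\<forall>t\<in>S - S \<inter> N. w v t = 0" by blast
qed (use assms in auto)

text \<open>Take \<open>S = {v}\<close> in the toughness condition: at least one component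
  remains.\<close>

lemma weighted_tough_budget_pos:
  assumes "pair_graph G" "edge_weight G w" "weighted_tough G w g" "v \<in> pverts G" "pverts G \<noteq> {v}"
  shows "1 \<le> g v"
proof -
  interpret pair_graph G by fact
  have "components (parcs G) (pverts G - {v}) \<noteq> {}"
    using assms by (auto simp: components_def)
  then have "0 < card (components (parcs G) (pverts G - {v}))"
    using pair_finite_verts by (simp add: card_gt_0_iff components_def)
  moreover have "2 * int (card (components (parcs G) (pverts G - {v}))) + w v v \<le> 2 * g v"
    using assms(3)[unfolded weighted_tough_def, rule_format, of "{v}"] assms(4) by simp
  moreover have "0 \<le> w v v" using assms(2) by (simp add: edge_weight_def)
  ultimately show ?thesis by linarith
qed

section \<open>Contraction of a vertex of degree 1 or 2: weights, toughness and expansion of the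
  tree\<close>

text \<open>Adding \<open>\<delta>\<close> in both orders keeps the weight symmetric. Degree 1 is
  treated with \<open>a = b\<close> and \<open>\<delta> = 0\<close>.\<close>

definition reduced_weight :: "'a \<Rightarrow> 'a \<Rightarrow> 'a \<Rightarrow> int \<Rightarrow> ('a \<Rightarrow> 'a \<Rightarrow> int) \<Rightarrow> 'a \<Rightarrow> 'a \<Rightarrow> int" where
  "reduced_weight v a b \<delta> w s t =
    (if s = v \<or> t = v then 0
     else w s t + (if s = a \<and> t = b then \<delta> else 0) + (if s = b \<and> t = a then \<delta> else 0))"

lemma sum_reduced_weight:
  assumes "finite S" "v \<notin> S"
  shows "(\<Sum>s\<in>S. \<Sum>t\<in>S. reduced_weight v a b \<delta> w s t)
    = (\<Sum>s\<in>S. \<Sum>t\<in>S. w s t) + (if a \<in> S \<and> b \<in> S then 2 * \<delta> else 0)"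
proof -
  have delta: "(\<Sum>s\<in>S. \<Sum>t\<in>S. if s = y \<and> t = z then \<delta> else 0) = (if y \<in> S \<and> z \<in> S then \<delta> else 0)" for y z
  proof -
    have "(\<Sum>t\<in>S. if s = y \<and> t = z then \<delta> else 0) = (if s = y then (if z \<in> S then \<delta> else 0) else 0)" for s
      using assms(1) by (cases "s = y") simp_all
    then show ?thesis using assms(1) by simp
  qed
  have "(\<Sum>s\<in>S. \<Sum>t\<in>S. reduced_weight v a b \<delta> w s t) = (\<Sum>s\<in>S. \<Sum>t\<in>S. w s t +
      (if s = a \<and> t = b then \<delta> else 0) + (if s = b \<and> t = a then \<delta> else 0))"
  proof (intro sum.cong refl)
    fix s t assume "s \<in> S" "t \<in> S"
    then have "s \<noteq> v" "t \<noteq> v" using assms(2) by auto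
    then show "reduced_weight v a b \<delta> w s t = w s t + (if s = a \<and> t = b then \<delta> else 0) + (if s = b \<and> t = a then \<delta> else 0)"
      unfolding reduced_weight_def by simp
  qed
  then show ?thesis by (simp add: sum.distrib delta)
qed

lemma edge_weight_contract_edge:
  assumes "pair_graph G" "edge_weight G w" "parcs G `` {v} = {a,b}" "0 \<le> \<delta>" "a = b \<Longrightarrow> \<delta> = 0"
  shows "edge_weight (contract_edge a v G) (reduced_weight v a b \<delta> w)"
proof -
  interpret pair_graph G by fact
  have w: "0 \<le> w s t" "w s t = w t s" "(s,t) \<notin> parcs G \<Longrightarrow> w s t = 0" for s t
    using assms(2) unfolding edge_weight_def by blast+
  show ?thesis
    unfolding edge_weight_def
  proof (intro allI conjI impI)
    fix s t
    show "0 \<le> reduced_weight v a b \<delta> w s t" using w(1) assms(4) by (simp add: reduced_weight_def)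
    show "reduced_weight v a b \<delta> w s t = reduced_weight v a b \<delta> w t s" 
      unfolding reduced_weight_def w(2)[of s t] by (simp add: conj_commute disj_commute)
    assume "(s,t) \<notin> parcs (contract_edge a v G)"
    then have st: "s = v \<or> t = v \<or> (s,t) \<notin> parcs G" "(s,t) \<notin> {(a,b),(b,a)} - Id"
      unfolding parcs_contract_edge[OF assms(3)] by blast+
    from st(1) consider "s = v \<or> t = v" | "w s t = 0" using w(3) by blast
    then show "reduced_weight v a b \<delta> w s t = 0"
    proof cases
      case 2
      consider "\<delta> = 0" | "\<not> (s = a \<and> t = b)" "\<not> (s = b \<and> t = a)" using st(2) assms(5) by blast
      then show ?thesis by cases (simp_all only: reduced_weight_def 2 if_False add_0_right if_cancel)
    qed (simp add: reduced_weight_def)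
  qed
qed

text \<open>The conditions in \<open>G\<close> for \<open>S\<close> and for
  \<open>insert v S\<close> are combined. If \<open>a\<close> and \<open>b\<close> lie in
  \<open>S\<close>, then \<open>v\<close> is an extra component of \<open>G - S\<close>, so the two
  conditions leave a slack of 1 and of \<open>w v a + w v b - g v\<close>; the maximum is
  \<open>ma + mb + \<delta>\<close>. If only \<open>a\<close> lies in \<open>S\<close>, the slacks
  are 0 and \<open>w v a - g v\<close>, with maximum \<open>ma\<close>; likewise for
  \<open>b\<close>.\<close>

lemma weighted_tough_contract_degree_2:
  fixes w :: "'a \<Rightarrow> 'a \<Rightarrow> int"
  assumes "pair_graph G" "edge_weight G w" "weighted_tough G w g"
    and v: "parcs G `` {v} = {a,b}" "a \<noteq> b"
    and ma: "ma = max 0 (w v a - g v)" and mb: "mb = max 0 (w v b - g v)"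
    and \<delta>: "\<delta> = max 1 (w v a + w v b - g v) - ma - mb"
  shows "weighted_tough (contract_edge a v G) (reduced_weight v a b \<delta> w)
    (\<lambda>u. g u - (if u = a then ma else 0) - (if u = b then mb else 0))"
  unfolding weighted_tough_def
proof (intro allI impI)
  interpret pair_graph G by fact
  have "(v,a) \<in> parcs G" "(v,b) \<in> parcs G" using v by auto
  then have V: "v \<in> pverts G" "a \<in> pverts G" "b \<in> pverts G" "a \<noteq> v" "b \<noteq> v"
    using arc_ends[of v a] arc_ends[of v b] by auto
  have \<gamma>: "1 \<le> g v" using weighted_tough_budget_pos[OF assms(1-3) V(1)] V by blast
  have pq: "0 \<le> w v a" "0 \<le> w v b" using assms(2) by (simp_all add: edge_weight_def)
  fix S assume "S \<subseteq> pverts (contract_edge a v G)" and "S \<noteq> {}"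
  then have S: "S \<subseteq> pverts G" "v \<notin> S" "S \<noteq> {}" by (auto simp: contract_edge_def)
  have fin: "finite S" using S finite_subset pair_finite_verts by blast
  define c c' where "c = int (card (components (parcs G) (pverts G - S)))"
    and "c' = int (card (components (parcs (contract_edge a v G)) (pverts (contract_edge a v G) - S)))"
  define W where "W = (\<Sum>s\<in>S. \<Sum>t\<in>S. w s t)"
  have pv: "pverts (contract_edge a v G) - S = pverts G - {v} - S" by (simp add: contract_edge_def)
  have excluded: "2 * c + W \<le> 2 * sum g S"
    using assms(3) S unfolding weighted_tough_def c_def W_def by blast
  \<comment> \<open>Deleting \<open>v\<close> as well leaves the components of the contracted graph
    without \<open>S\<close>; \<open>v\<close> adds its budget on one side and the weights of its
    edges into \<open>S\<close> on the other.\<close>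
  have included: "2 * c' + W + 2 * ((if a \<in> S then w v a else 0) + (if b \<in> S then w v b else 0))
      \<le> 2 * sum g S + 2 * g v" if "a \<in> S \<or> b \<in> S"
  proof -
    have "(\<Sum>t\<in>S. w v t) = (\<Sum>t\<in>S \<inter> {a,b}. w v t)"
      using sum_weight_neighbours[OF assms(2) fin] v by simp
    also have "\<dots> = (if a \<in> S then w v a else 0) + (if b \<in> S then w v b else 0)"
      using v(2) by (simp add: Int_insert_right)
    finally have "(\<Sum>s\<in>insert v S. \<Sum>t\<in>insert v S. w s t)
        = W + 2 * ((if a \<in> S then w v a else 0) + (if b \<in> S then w v b else 0))"
      using sum_weight_insert[OF assms(2,1) fin S(2)] by (simp add: W_def)
    moreover have "2 * int (card (components (parcs G) (pverts G - insert v S)))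
        + (\<Sum>s\<in>insert v S. \<Sum>t\<in>insert v S. w s t) \<le> 2 * sum g (insert v S)"
      using assms(3)[unfolded weighted_tough_def, rule_format, of "insert v S"] S V by blast
    moreover have "sum g (insert v S) = sum g S + g v" using fin S(2) by simp
    moreover have "int (card (components (parcs G) (pverts G - insert v S))) = c'"
      unfolding c'_def pv using components_contract_edge_eq[OF v(1) that] by simp
    ultimately show ?thesis by linarith
  qed
  have c: "c' \<le> c" if "\<not> (a \<in> S \<and> b \<in> S)"
    using components_contract_edge_le[OF v(1) _ S(2)] that unfolding c_def c'_def pv by simp
  have c1: "c = c' + 1" if "a \<in> S" "b \<in> S"
    using components_isolated[of v S] components_contract_edge_eq[OF v(1), of S] that v S(2) V(1)
    unfolding c_def c'_def pv by simp
  have W': "(\<Sum>s\<in>S. \<Sum>t\<in>S. reduced_weight v a b \<delta> w s t) = W + (if a \<in> S \<and> b \<in> S then 2 * \<delta> else 0)"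
    using sum_reduced_weight[OF fin S(2)] by (simp add: W_def)
  have g': "(\<Sum>u\<in>S. g u - (if u = a then ma else 0) - (if u = b then mb else 0))
      = sum g S - (if a \<in> S then ma else 0) - (if b \<in> S then mb else 0)"
    using fin by (simp add: sum_subtractf)
  have "2 * c' + (W + (if a \<in> S \<and> b \<in> S then 2 * \<delta> else 0))
      \<le> 2 * (sum g S - (if a \<in> S then ma else 0) - (if b \<in> S then mb else 0))"
    using excluded included c c1 \<gamma> pq unfolding ma mb \<delta> by (cases "a \<in> S"; cases "b \<in> S") (auto simp: max_def)
  then show "2 * int (card (components (parcs (contract_edge a v G)) (pverts (contract_edge a v G) - S)))
      + (\<Sum>s\<in>S. \<Sum>t\<in>S. reduced_weight v a b \<delta> w s t)
      \<le> 2 * (\<Sum>u\<in>S. g u - (if u = a then ma else 0) - (if u = b then mb else 0))"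
    unfolding W' g' c'_def .
qed

text \<open>The same two conditions leave a slack of 1 and of \<open>w v a - g v\<close> when
  \<open>a\<close> lies in \<open>S\<close>. Here all of it is charged to \<open>a\<close>.\<close>

lemma weighted_tough_contract_degree_1:
  fixes w :: "'a \<Rightarrow> 'a \<Rightarrow> int"
  assumes "pair_graph G" "edge_weight G w" "weighted_tough G w g"
    and v: "parcs G `` {v} = {a}" and ma: "ma = max 1 (w v a - g v)"
  shows "weighted_tough (contract_edge a v G) (reduced_weight v a a 0 w) (\<lambda>u. g u - (if u = a then ma else 0))"
  unfolding weighted_tough_def
proof (intro allI impI)
  interpret pair_graph G by fact
  have v2: "parcs G `` {v} = {a,a}" using v by simp
  have "(v,a) \<in> parcs G" using v by auto
  then have V: "v \<in> pverts G" "a \<in> pverts G" "a \<noteq> v"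
    using arc_ends[of v a] by auto
  fix S assume "S \<subseteq> pverts (contract_edge a v G)" and "S \<noteq> {}"
  then have S: "S \<subseteq> pverts G" "v \<notin> S" "S \<noteq> {}" by (auto simp: contract_edge_def)
  have fin: "finite S" using S finite_subset pair_finite_verts by blast
  define c c' where "c = int (card (components (parcs G) (pverts G - S)))"
    and "c' = int (card (components (parcs (contract_edge a v G)) (pverts (contract_edge a v G) - S)))"
  define W where "W = (\<Sum>s\<in>S. \<Sum>t\<in>S. w s t)"
  have pv: "pverts (contract_edge a v G) - S = pverts G - {v} - S" by (simp add: contract_edge_def)
  have excluded: "2 * c + W \<le> 2 * sum g S"
    using assms(3) S unfolding weighted_tough_def c_def W_def by blast
  have included: "2 * c' + W + 2 * w v a \<le> 2 * sum g S + 2 * g v" if "a \<in> S"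
  proof -
    have "(\<Sum>t\<in>S. w v t) = (\<Sum>t\<in>S \<inter> {a}. w v t)"
      using sum_weight_neighbours[OF assms(2) fin] v by simp
    also have "\<dots> = w v a"
      using that by (simp add: Int_insert_right)
    finally have "(\<Sum>s\<in>insert v S. \<Sum>t\<in>insert v S. w s t) = W + 2 * w v a"
      using sum_weight_insert[OF assms(2,1) fin S(2)] by (simp add: W_def)
    moreover have "2 * int (card (components (parcs G) (pverts G - insert v S)))
        + (\<Sum>s\<in>insert v S. \<Sum>t\<in>insert v S. w s t) \<le> 2 * sum g (insert v S)"
      using assms(3)[unfolded weighted_tough_def, rule_format, of "insert v S"] S V by blast
    moreover have "sum g (insert v S) = sum g S + g v" using fin S(2) by simp
    moreover have "int (card (components (parcs G) (pverts G - insert v S))) = c'"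
      unfolding c'_def pv using components_contract_edge_eq[OF v2, of S] that by simp
    ultimately show ?thesis by linarith
  qed
  have c: "c' \<le> c" if "a \<notin> S"
    using components_contract_edge_le[OF v2 _ S(2)] that unfolding c_def c'_def pv by simp
  have c1: "c = c' + 1" if "a \<in> S"
    using components_isolated[of v S] components_contract_edge_eq[OF v2, of S] that v S(2) V(1)
    unfolding c_def c'_def pv by simp
  have W': "(\<Sum>s\<in>S. \<Sum>t\<in>S. reduced_weight v a a 0 w s t) = W"
    using sum_reduced_weight[OF fin S(2), of a a 0 w] by (simp add: W_def)
  have g': "(\<Sum>u\<in>S. g u - (if u = a then ma else 0)) = sum g S - (if a \<in> S then ma else 0)"
    using fin by (simp add: sum_subtractf)
  have "2 * c' + W \<le> 2 * (sum g S - (if a \<in> S then ma else 0))"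
    using excluded included c c1 unfolding ma by (cases "a \<in> S") (auto simp: max_def)
  then show "2 * int (card (components (parcs (contract_edge a v G)) (pverts (contract_edge a v G) - S)))
      + (\<Sum>s\<in>S. \<Sum>t\<in>S. reduced_weight v a a 0 w s t) \<le> 2 * (\<Sum>u\<in>S. g u - (if u = a then ma else 0))"
    unfolding W' g' c'_def .
qed

text \<open>
  The surplus of \<open>m a b + m b a\<close> over \<open>w a b\<close> is diverted to the path \<open>avb\<close>: the shares \<open>i\<close> of \<open>a\<close>
  and \<open>j\<close> of \<open>b\<close> relieve \<open>v\<close>. If \<open>i \<ge> 1\<close>, then \<open>v\<close> is left with a unit for the edge \<open>vb\<close>, so that
  the tree edge \<open>ab\<close> can be subdivided.
\<close>

lemma paid_tree_expand_degree_2: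
  fixes w :: "'a \<Rightarrow> 'a \<Rightarrow> int"
  assumes "pair_graph G" "edge_weight G w" "v \<noteq> x" "1 \<le> g v"
    and v: "parcs G `` {v} = {a,b}" "a \<noteq> b"
    and ma: "ma = max 0 (w v a - g v)" and mb: "mb = max 0 (w v b - g v)"
    and \<delta>: "\<delta> = max 1 (w v a + w v b - g v) - ma - mb"
    and tree: "paid_tree (contract_edge a v G) (reduced_weight v a b \<delta> w)
      (\<lambda>u. g u - (if u = a then ma else 0) - (if u = b then mb else 0)) x \<pi> d m"
    and not_ba: "a = x \<or> \<pi> a \<noteq> b"
  shows "\<exists>\<pi> d m. paid_tree G w g x \<pi> d m"
proof -
  interpret pair_graph G by fact
  have arcs: "(v,a) \<in> parcs G" "(v,b) \<in> parcs G" "(a,v) \<in> parcs G" "(b,v) \<in> parcs G"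
    using v arcs_sym by auto
  then have V: "v \<in> pverts G" "a \<in> pverts G" "b \<in> pverts G" "a \<noteq> v" "b \<noteq> v"
    using arc_ends[of v a] arc_ends[of v b] by auto
  have nv: "(v,t) \<in> parcs G \<longleftrightarrow> t = a \<or> t = b" for t using v by auto
  have nv': "(t,v) \<in> parcs G \<longleftrightarrow> t = a \<or> t = b" for t using nv arcs_sym by blast
  have w: "0 \<le> w s t" "w s t = w t s" "(s,t) \<notin> parcs G \<Longrightarrow> w s t = 0" for s t
    using assms(2) unfolding edge_weight_def by blast+
  have parcs': "(s,t) \<in> parcs (contract_edge a v G) \<longleftrightarrow>
      (s,t) \<in> parcs G \<and> s \<noteq> v \<and> t \<noteq> v \<or> s = a \<and> t = b \<or> s = b \<and> t = a" for s t
    unfolding parcs_contract_edge[OF v(1)] using v(2) by auto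
  define V' where "V' = pverts G - {v}"
  have V': "pverts (contract_edge a v G) = V'" "finite V'" "a \<in> V'" "b \<in> V'" "v \<notin> V'" "pverts G = insert v V'"
    using V pair_finite_verts by (auto simp: V'_def contract_edge_def)
  have tree_arc: "(\<pi> u, u) \<in> parcs (contract_edge a v G)" "d (\<pi> u) < d u" "1 \<le> m (\<pi> u) u"
    if "u \<in> V'" "u \<noteq> x" for u
    using tree that unfolding paid_tree_def V'(1) by blast+
  have m_nonneg: "0 \<le> m s t" for s t
    using tree unfolding paid_tree_def by blast
  have m_weight: "reduced_weight v a b \<delta> w s t \<le> m s t + m t s" if "(s,t) \<in> parcs (contract_edge a v G)" for s t
    using tree that unfolding paid_tree_def by blast
  have m_budget: "(\<Sum>t\<in>V'. m s t) \<le> g s - (if s = a then ma else 0) - (if s = b then mb else 0)"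
    if "s \<in> V'" for s
    using tree that unfolding paid_tree_def V'(1) by blast
  have mab: "w a b + \<delta> \<le> m a b + m b a"
    using m_weight[of a b] V v(2) by (simp add: parcs' reduced_weight_def)
  \<comment> \<open>\<open>w a b\<close> is covered first from the share of \<open>a\<close>, then
    from that of \<open>b\<close>; \<open>i\<close> and \<open>j\<close> are what remains of the two
    shares.\<close>
  define i where "i = m a b - min (m a b) (w a b)"
  define j where "j = m b a - min (m b a) (w a b - min (m a b) (w a b))"
  define ra where "ra = ma + i"
  define rb where "rb = mb + j"
  \<comment> \<open>\<open>v\<close> pays on \<open>va\<close> only what \<open>ra\<close> leaves
    open and puts the rest of its budget on \<open>vb\<close>.\<close>
  define sa where "sa = max 0 (w v a - ra)"
  define sb where "sb = g v - sa"
  have split: "0 \<le> i" "0 \<le> j" "i \<le> m a b" "j \<le> m b a" "w a b \<le> (m a b - i) + (m b a - j)" "\<delta> \<le> i + j"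
    "i = 0 \<Longrightarrow> m a b \<le> w a b"
    using mab m_nonneg[of a b] m_nonneg[of b a] w(1)[of a b] w(1)[of v a] w(1)[of v b] assms(4)
    unfolding i_def j_def \<delta> ma mb by linarith+
  \<comment> \<open>For \<open>w v b \<le> sb + rb\<close>: if \<open>sa = 0\<close>, then
    \<open>mb\<close> covers what exceeds \<open>g v\<close>; otherwise \<open>ra + rb\<close> is at
    least \<open>w v a + w v b - g v\<close>.\<close>
  have pay: "0 \<le> ra" "0 \<le> rb" "0 \<le> sa" "0 \<le> sb" "w v a \<le> sa + ra" "w v b \<le> sb + rb"
    "1 \<le> i \<Longrightarrow> 1 \<le> sb" "1 \<le> i \<Longrightarrow> 1 \<le> ra" "1 \<le> ra \<or> 1 \<le> rb"
    using split(1,2,6) w(1)[of v a] w(1)[of v b] assms(4)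
    unfolding sb_def sa_def ra_def rb_def \<delta> ma mb by linarith+
  define m' where "m' s t =
    (if s = v then (if t = a then sa else 0) + (if t = b then sb else 0)
     else if t = v then (if s = a then ra else 0) + (if s = b then rb else 0)
     else m s t - (if s = a \<and> t = b then i else 0) - (if s = b \<and> t = a then j else 0))" for s t
  have m'_v: "m' v a = sa" "m' v b = sb" "m' a v = ra" "m' b v = rb" "m' a b = m a b - i" "m' b a = m b a - j"
    using V v(2) by (auto simp: m'_def)
  have m'_other: "m' s t = m s t" if "s \<noteq> v" "t \<noteq> v" "\<not> (s = a \<and> t = b)" "\<not> (s = b \<and> t = a)" for s t
    by (simp only: m'_def that if_False diff_0_right)
  have m'_nonneg: "0 \<le> m' s t" for s t
    using pay(1-4) split(3,4) m_nonneg[of s t] v(2) by (auto simp: m'_def)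
  have m'_weight: "w s t \<le> m' s t + m' t s" if st: "(s,t) \<in> parcs G" for s t
  proof -
    consider "s = v" "t = a" | "s = v" "t = b" | "t = v" "s = a" | "t = v" "s = b"
      | "s = a" "t = b" | "s = b" "t = a"
      | "s \<noteq> v" "t \<noteq> v" "\<not> (s = a \<and> t = b)" "\<not> (s = b \<and> t = a)"
      using st nv[of t] nv'[of s] by blast
    then show ?thesis
    proof cases
      case 7
      then have "(s,t) \<in> parcs (contract_edge a v G)" using st parcs'[of s t] by blast
      moreover have "reduced_weight v a b \<delta> w s t = w s t" by (simp only: reduced_weight_def 7 if_False simp_thms add_0_right)
      ultimately have "w s t \<le> m s t + m t s" using m_weight[of s t] by simp
      moreover have "m' s t = m s t" "m' t s = m t s" using 7 by (auto intro!: m'_other)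
      ultimately show ?thesis by simp
    qed (use pay(5,6) split(5) w(2)[of a v] w(2)[of b v] w(2)[of b a] in \<open>simp_all add: m'_v\<close>)
  qed
  have m'_budget: "(\<Sum>t\<in>pverts G. m' s t) \<le> g s" if "s \<in> pverts G" for s
  proof (cases "s = v")
    case True
    have "(\<Sum>t\<in>pverts G. m' v t) = (\<Sum>t\<in>pverts G. (if t = a then sa else 0) + (if t = b then sb else 0))"
      by (simp add: m'_def)
    also have "\<dots> = sa + sb" using V pair_finite_verts by (simp add: sum.distrib)
    finally show ?thesis using True by (simp add: sb_def)
  next
    case False
    have "(\<Sum>t\<in>V'. m' s t) = (\<Sum>t\<in>V'. m s t - (if t = b then if s = a then i else 0 else 0)
        - (if t = a then if s = b then j else 0 else 0))"
      using False V'(5) by (intro sum.cong refl) (auto simp: m'_def)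
    also have "\<dots> = (\<Sum>t\<in>V'. m s t) - (if s = a then i else 0) - (if s = b then j else 0)"
      using V' by (simp add: sum_subtractf)
    finally have "(\<Sum>t\<in>pverts G. m' s t)
        = (\<Sum>t\<in>V'. m s t) - (if s = a then i else 0) - (if s = b then j else 0) + m' s v"
      using V'(2,5,6) by simp
    also have "m' s v = (if s = a then ra else 0) + (if s = b then rb else 0)"
      using False by (simp add: m'_def)
    finally show ?thesis
      using m_budget[of s] that False V'(6) v(2) by (auto simp: ra_def rb_def split: if_splits)
  qed
  \<comment> \<open>The tree edge from \<open>a\<close> to its child \<open>b\<close> is set apart,
    since in \<open>G\<close> it may be missing or no longer paid. The reverse edge is excluded by
    \<open>not_ba\<close>.\<close>
  have old_arc: "(\<pi> u, u) \<in> parcs G \<and> 2 * d (\<pi> u) < 2 * d u \<and> 1 \<le> m' (\<pi> u) u \<and> \<pi> u \<noteq> v"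
    if "u \<in> V'" "u \<noteq> x" "u = b \<Longrightarrow> \<pi> u \<noteq> a" for u
  proof -
    have "\<not> (\<pi> u = a \<and> u = b)" "\<not> (\<pi> u = b \<and> u = a)" using that not_ba by auto
    moreover have "\<pi> u \<noteq> v" "u \<noteq> v" using tree_arc(1)[OF that(1,2)] V by (auto simp: parcs')
    ultimately show ?thesis
      using tree_arc[OF that(1,2)] m'_other[of "\<pi> u" u] parcs'[of "\<pi> u" u] by auto
  qed
  show ?thesis
  proof (cases "b \<noteq> x \<and> \<pi> b = a \<and> 1 \<le> i")
    case True
    \<comment> \<open>\<open>v\<close> is inserted between \<open>a\<close> and its child
      \<open>b\<close>. Doubling \<open>d\<close> leaves an odd value free between theirs.\<close>
    have "paid_tree G w g x (\<pi>(v := a, b := v)) ((\<lambda>u. 2 * d u)(v := 2 * d a + 1)) m'"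
      unfolding paid_tree_def
    proof (intro conjI ballI allI impI)
      fix u assume u: "u \<in> pverts G - {x}"
      consider "u = v" | "u = b" | "u \<in> V'" "u \<noteq> b" using u V'(6) by blast
      then have "((\<pi>(v := a, b := v)) u, u) \<in> parcs G \<and>
          ((\<lambda>u. 2 * d u)(v := 2 * d a + 1)) ((\<pi>(v := a, b := v)) u) < ((\<lambda>u. 2 * d u)(v := 2 * d a + 1)) u \<and>
          1 \<le> m' ((\<pi>(v := a, b := v)) u) u"
      proof cases
        case 1
        then show ?thesis using V arcs True pay(8) by (simp add: m'_v)
      next
        case 2
        then show ?thesis using V arcs True pay(7) tree_arc(2)[of b] V'(4) by (simp add: m'_v)
      next
        case 3
        then have "u \<noteq> v" using V'(5) by auto
        then show ?thesis using old_arc[of u] 3 u by simp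
      qed
      then show "((\<pi>(v := a, b := v)) u, u) \<in> parcs G"
        "((\<lambda>u. 2 * d u)(v := 2 * d a + 1)) ((\<pi>(v := a, b := v)) u) < ((\<lambda>u. 2 * d u)(v := 2 * d a + 1)) u"
        "1 \<le> m' ((\<pi>(v := a, b := v)) u) u" by blast+
    qed (use m'_nonneg m'_weight m'_budget in blast)+
    then show ?thesis by blast
  next
    case False
    \<comment> \<open>Now \<open>v\<close> becomes a leaf below a neighbour that pays at least 1 for
      it; \<open>pay\<close> provides one.\<close>
    define z where "z = (if 1 \<le> ra then a else b)"
    have z: "z \<noteq> v" "(z,v) \<in> parcs G" "1 \<le> m' z v"
      using V arcs pay(9) by (auto simp: z_def m'_v)
    have "paid_tree G w g x (\<pi>(v := z)) ((\<lambda>u. 2 * d u)(v := 2 * d z + 1)) m'"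
      unfolding paid_tree_def
    proof (intro conjI ballI allI impI)
      fix u assume u: "u \<in> pverts G - {x}"
      consider "u = v" | "u = b" "\<pi> u = a" | "u \<in> V'" "u = b \<Longrightarrow> \<pi> u \<noteq> a" using u V'(6) by blast
      then have "((\<pi>(v := z)) u, u) \<in> parcs G \<and>
          ((\<lambda>u. 2 * d u)(v := 2 * d z + 1)) ((\<pi>(v := z)) u) < ((\<lambda>u. 2 * d u)(v := 2 * d z + 1)) u \<and>
          1 \<le> m' ((\<pi>(v := z)) u) u"
      proof cases
        case 1
        then show ?thesis using z by simp
      next
        case 2
        then have "i = 0" "1 \<le> m a b" using False split(1) u tree_arc(3)[of b] V'(4) by auto
        \<comment> \<open>With \<open>i = 0\<close>, all that \<open>a\<close> pays for its child
          \<open>b\<close> covers old weight. Hence \<open>ab\<close> is an edge of \<open>G\<close>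
          already, not one created by the contraction.\<close>
        then have "1 \<le> w a b" using split(7) by linarith
        then have "(a,b) \<in> parcs G" using w(3)[of a b] by auto
        then show ?thesis
          using 2 V u tree_arc(2)[of b] V'(4) \<open>i = 0\<close> \<open>1 \<le> m a b\<close> by (simp add: m'_v)
      next
        case 3
        then have "u \<noteq> v" using V'(5) by auto
        then show ?thesis using old_arc[of u] 3 u by simp
      qed
      then show "((\<pi>(v := z)) u, u) \<in> parcs G"
        "((\<lambda>u. 2 * d u)(v := 2 * d z + 1)) ((\<pi>(v := z)) u) < ((\<lambda>u. 2 * d u)(v := 2 * d z + 1)) u"
        "1 \<le> m' ((\<pi>(v := z)) u) u" by blast+
    qed (use m'_nonneg m'_weight m'_budget in blast)+
    then show ?thesis by blast
  qed
qed

text \<open>\<open>v\<close> becomes a leaf below \<open>a\<close>, which pays \<open>ma\<close>, at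
  least 1. \<open>v\<close> spends its whole budget on the same edge, and together they cover its
  weight.\<close>

lemma paid_tree_expand_degree_1:
  fixes w :: "'a \<Rightarrow> 'a \<Rightarrow> int"
  assumes "pair_graph G" "edge_weight G w" "v \<noteq> x" "1 \<le> g v"
    and v: "parcs G `` {v} = {a}" and ma: "ma = max 1 (w v a - g v)"
    and tree: "paid_tree (contract_edge a v G) (reduced_weight v a a 0 w)
      (\<lambda>u. g u - (if u = a then ma else 0)) x \<pi> d m"
  shows "\<exists>\<pi> d m. paid_tree G w g x \<pi> d m"
proof -
  interpret pair_graph G by fact
  have arcs: "(v,a) \<in> parcs G" "(a,v) \<in> parcs G"
    using v arcs_sym by auto
  then have V: "v \<in> pverts G" "a \<in> pverts G" "a \<noteq> v"
    using arc_ends[of v a] by auto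
  have nv: "(v,t) \<in> parcs G \<longleftrightarrow> t = a" for t using v by auto
  have nv': "(t,v) \<in> parcs G \<longleftrightarrow> t = a" for t using nv arcs_sym by blast
  have w: "w s t = w t s" for s t
    using assms(2) unfolding edge_weight_def by blast
  have "parcs G `` {v} = {a,a}" using v by simp
  from parcs_contract_edge[OF this]
  have parcs': "(s,t) \<in> parcs (contract_edge a v G) \<longleftrightarrow> (s,t) \<in> parcs G \<and> s \<noteq> v \<and> t \<noteq> v" for s t
    by auto
  define V' where "V' = pverts G - {v}"
  have V': "pverts (contract_edge a v G) = V'" "finite V'" "a \<in> V'" "v \<notin> V'" "pverts G = insert v V'"
    using V pair_finite_verts by (auto simp: V'_def contract_edge_def)
  have tree_arc: "(\<pi> u, u) \<in> parcs (contract_edge a v G)" "d (\<pi> u) < d u" "1 \<le> m (\<pi> u) u"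
    if "u \<in> V'" "u \<noteq> x" for u
    using tree that unfolding paid_tree_def V'(1) by blast+
  have m_nonneg: "0 \<le> m s t" for s t
    using tree unfolding paid_tree_def by blast
  have m_weight: "reduced_weight v a a 0 w s t \<le> m s t + m t s" if "(s,t) \<in> parcs (contract_edge a v G)" for s t
    using tree that unfolding paid_tree_def by blast
  have m_budget: "(\<Sum>t\<in>V'. m s t) \<le> g s - (if s = a then ma else 0)" if "s \<in> V'" for s
    using tree that unfolding paid_tree_def V'(1) by blast
  define m' where "m' s t =
    (if s = v then if t = a then g v else 0 else if t = v then if s = a then ma else 0 else m s t)" for s t
  have m'_nonneg: "0 \<le> m' s t" for s t
    using assms(4) m_nonneg[of s t] by (auto simp: m'_def ma)
  have m'_weight: "w s t \<le> m' s t + m' t s" if st: "(s,t) \<in> parcs G" for s t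
  proof -
    consider "s = v" "t = a" | "t = v" "s = a" | "s \<noteq> v" "t \<noteq> v"
      using st nv[of t] nv'[of s] by blast
    then show ?thesis
    proof cases
      case 3
      then show ?thesis using st m_weight[of s t] by (simp add: parcs' m'_def reduced_weight_def)
    qed (use V w[of a v] in \<open>simp_all add: m'_def ma\<close>)
  qed
  have m'_budget: "(\<Sum>t\<in>pverts G. m' s t) \<le> g s" if "s \<in> pverts G" for s
  proof (cases "s = v")
    case True
    then show ?thesis using V pair_finite_verts by (simp add: m'_def)
  next
    case False
    have "(\<Sum>t\<in>V'. m' s t) = (\<Sum>t\<in>V'. m s t)"
      using False V'(4) by (intro sum.cong refl) (auto simp: m'_def)
    then have "(\<Sum>t\<in>pverts G. m' s t) = (\<Sum>t\<in>V'. m s t) + (if s = a then ma else 0)"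
      using V'(2,4,5) False by (simp add: m'_def)
    then show ?thesis using m_budget[of s] that False V'(5) by auto
  qed
  have "paid_tree G w g x (\<pi>(v := a)) (d(v := d a + 1)) m'"
    unfolding paid_tree_def
  proof (intro conjI ballI allI impI)
    fix u assume u: "u \<in> pverts G - {x}"
    have "((\<pi>(v := a)) u, u) \<in> parcs G \<and> (d(v := d a + 1)) ((\<pi>(v := a)) u) < (d(v := d a + 1)) u
        \<and> 1 \<le> m' ((\<pi>(v := a)) u) u"
    proof (cases "u = v")
      case True
      then show ?thesis using V arcs by (simp add: m'_def ma)
    next
      case False
      then have "u \<in> V'" "u \<noteq> x" using u V'(5) by auto
      from tree_arc[OF this] show ?thesis using False by (simp add: parcs' m'_def)
    qed
    then show "((\<pi>(v := a)) u, u) \<in> parcs G" "(d(v := d a + 1)) ((\<pi>(v := a)) u) < (d(v := d a + 1)) u"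
      "1 \<le> m' ((\<pi>(v := a)) u) u" by blast+
  qed (use m'_nonneg m'_weight m'_budget in blast)+
  then show ?thesis by blast
qed

text \<open>As \<open>d\<close> decreases towards the parent, \<open>a\<close> and \<open>b\<close>
  are not parents of each other. The reduced data are symmetric in \<open>a\<close> and
  \<open>b\<close>, so the two may be exchanged.\<close>

lemma paid_tree_expand_degree_2_sym:
  fixes w :: "'a \<Rightarrow> 'a \<Rightarrow> int"
  assumes "pair_graph G" "edge_weight G w" "v \<noteq> x" "1 \<le> g v" "x \<in> pverts G"
    and v: "parcs G `` {v} = {a,b}" "a \<noteq> b"
    and ma: "ma = max 0 (w v a - g v)" and mb: "mb = max 0 (w v b - g v)"
    and \<delta>: "\<delta> = max 1 (w v a + w v b - g v) - ma - mb"
    and tree: "paid_tree (contract_edge a v G) (reduced_weight v a b \<delta> w)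
      (\<lambda>u. g u - (if u = a then ma else 0) - (if u = b then mb else 0)) x \<pi> d m"
  shows "\<exists>\<pi> d m. paid_tree G w g x \<pi> d m"
proof (cases "a = x \<or> \<pi> a \<noteq> b")
  case True
  then show ?thesis using paid_tree_expand_degree_2[where w = w and g = g, OF assms(1-4) v ma mb \<delta> tree] by blast
next
  case False
  interpret pair_graph G by fact
  have "(v,a) \<in> parcs G" "(v,b) \<in> parcs G" using v by auto
  then have V: "a \<in> pverts (contract_edge a v G)" "b \<in> pverts (contract_edge a v G)"
    using arc_ends[of v a] arc_ends[of v b] by (auto simp: contract_edge_def)
  have not_ab: "b = x \<or> \<pi> b \<noteq> a"
  proof (rule ccontr)
    assume *: "\<not> (b = x \<or> \<pi> b \<noteq> a)"
    have "\<forall>u\<in>pverts (contract_edge a v G) - {x}. d (\<pi> u) < d u"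
      using tree by (simp add: paid_tree_def)
    from bspec[OF this, of a] bspec[OF this, of b] show False using * V False by auto
  qed
  have nv: "parcs G `` {v} = {b,a}" using v(1) by auto
  have \<delta>': "\<delta> = max 1 (w v b + w v a - g v) - mb - ma" using \<delta> by simp
  have "paid_tree (contract_edge b v G) (reduced_weight v b a \<delta> w)
      (\<lambda>u. g u - (if u = b then mb else 0) - (if u = a then ma else 0)) x \<pi> d m"
  proof -
    have "reduced_weight v b a \<delta> w = reduced_weight v a b \<delta> w" by (intro ext) (simp add: reduced_weight_def)
    moreover have "(\<lambda>u. g u - (if u = b then mb else 0) - (if u = a then ma else 0)) =
        (\<lambda>u. g u - (if u = a then ma else 0) - (if u = b then mb else 0))"
      by (intro ext) simp
    ultimately show ?thesis using tree contract_edge_commute[OF v(1)] by simp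
  qed
  from paid_tree_expand_degree_2[where w = w and g = g, OF assms(1-4) nv v(2)[symmetric] mb ma \<delta>' this not_ab]
  show ?thesis .
qed

section \<open>Existence of paid trees by induction on the number of vertices\<close>

lemma card_le_2_cases:
  assumes "finite A" "card A \<le> 2" "A \<noteq> {}"
  obtains a where "A = {a}" | a b where "A = {a,b}" "a \<noteq> b"
proof -
  have "card A \<noteq> 0" using assms by simp
  then consider "card A = 1" | "card A = 2" using assms(2) by linarith
  then show thesis
  proof cases
    case 1
    then show thesis using that(1) by (auto simp: card_1_singleton_iff)
  next
    case 2
    then show thesis using that(2) by (auto simp: card_2_iff)
  qed
qed

text \<open>\<open>G\<close>, \<open>w\<close> and \<open>g\<close> vary because a contraction
  changes all three; \<open>x\<close> is fixed because the contracted vertex differs from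
  it.\<close>

lemma paid_tree_exists:
  fixes w :: "'a \<Rightarrow> 'a \<Rightarrow> int"
  assumes "pair_graph G" "K4_minor_free G" "card (components (parcs G) (pverts G)) \<le> 1" "x \<in> pverts G"
    and "edge_weight G w" "weighted_tough G w g"
  shows "\<exists>\<pi> d m. paid_tree G w g x \<pi> d m"
  using assms
proof (induction "card (pverts G)" arbitrary: G w g rule: less_induct)
  case less
  interpret pair_graph G by (rule less.prems)
  note weight = less.prems(5) and tough = less.prems(6)
  show ?case
  proof (cases "pverts G = {x}")
    case True
    then have "parcs G = {}" using arc_ends by (metis equals0I singletonD surj_pair)
    have "0 \<le> w x x" using weight by (simp add: edge_weight_def)
    then have "0 \<le> g x"
      using tough[unfolded weighted_tough_def, rule_format, of "{x}"] True by simp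
    then have "paid_tree G w g x (\<lambda>u. u) (\<lambda>u. 0) (\<lambda>u v. 0)"
      using True \<open>parcs G = {}\<close> by (simp add: paid_tree_def)
    then show ?thesis by blast
  next
    case False
    then obtain y where "(x,y) \<in> parcs G" using neighbour_exists less.prems(3,4) by blast
    then obtain v where v: "v \<in> pverts G" "v \<noteq> x" "card (parcs G `` {v}) \<le> 2"
      using K4_minor_free_low_degree[OF less.prems(1,2)] by blast
    have "pverts G \<noteq> {v}" using v less.prems by auto
    then have \<gamma>: "1 \<le> g v" and "parcs G `` {v} \<noteq> {}"
      using weighted_tough_budget_pos[OF less.prems(1) weight tough v(1)]
        neighbour_exists[OF less.prems(3) v(1)] by auto
    \<comment> \<open>\<open>a = b\<close> is allowed here, so this serves both degrees.\<close>
    have smaller: "\<exists>\<pi> d m. paid_tree (contract_edge a v G) w' g' x \<pi> d m"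
      if nv: "parcs G `` {v} = {a,b}" and w': "edge_weight (contract_edge a v G) w'"
        "weighted_tough (contract_edge a v G) w' g'" for a b w' g'
    proof (rule less.hyps)
      have "(a,v) \<in> parcs G" using nv arcs_sym by auto
      then have step: "minor_step G (contract_edge a v G)" by (rule edge_contraction)
      then show "pair_graph (contract_edge a v G)" "K4_minor_free (contract_edge a v G)"
        using pair_graph_minor_step K4_minor_free_minor_step less.prems by blast+
      show "card (pverts (contract_edge a v G)) < card (pverts G)"
        using card_Diff1_less[OF pair_finite_verts v(1)] by (simp add: contract_edge_def)
      show "card (components (parcs (contract_edge a v G)) (pverts (contract_edge a v G))) \<le> 1"
        using components_contract_edge_le[OF nv, of "{}"] less.prems(3) by (simp add: contract_edge_def)
      show "x \<in> pverts (contract_edge a v G)" using less.prems v by (simp add: contract_edge_def)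
    qed (fact w')+
    from v(3) \<open>parcs G `` {v} \<noteq> {}\<close> show ?thesis
    proof (rule card_le_2_cases[OF finite_neighbours])
      fix a assume nv: "parcs G `` {v} = {a}"
      then have nv2: "parcs G `` {v} = {a,a}" by simp
      obtain \<pi> d m where "paid_tree (contract_edge a v G) (reduced_weight v a a 0 w)
          (\<lambda>u. g u - (if u = a then max 1 (w v a - g v) else 0)) x \<pi> d m"
        using smaller[OF nv2 edge_weight_contract_edge[OF less.prems(1) weight nv2]
            weighted_tough_contract_degree_1[where w = w and g = g, OF less.prems(1) weight tough nv refl]] by auto
      then show ?thesis
        by (rule paid_tree_expand_degree_1[where w = w and g = g, OF less.prems(1) weight v(2) \<gamma> nv refl])
    next
      fix a b assume nv: "parcs G `` {v} = {a,b}" "a \<noteq> b"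
      define ma where "ma = max 0 (w v a - g v)"
      define mb where "mb = max 0 (w v b - g v)"
      define \<delta> where "\<delta> = max 1 (w v a + w v b - g v) - ma - mb"
      have "0 \<le> w v a" "0 \<le> w v b" using weight by (simp_all add: edge_weight_def)
      \<comment> \<open>If \<open>ma\<close> and \<open>mb\<close> are both positive, their sum is
        \<open>w v a + w v b - 2 * g v\<close>; if one is, it is at most
        \<open>w v a + w v b - g v\<close>, the weights being nonnegative.\<close>
      then have "0 \<le> \<delta>" using \<gamma> unfolding \<delta>_def ma_def mb_def by linarith
      then obtain \<pi> d m where "paid_tree (contract_edge a v G) (reduced_weight v a b \<delta> w)
          (\<lambda>u. g u - (if u = a then ma else 0) - (if u = b then mb else 0)) x \<pi> d m"
        using smaller[OF nv(1) edge_weight_contract_edge[OF less.prems(1) weight nv(1)]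
            weighted_tough_contract_degree_2[where w = w and g = g, OF less.prems(1) weight tough nv ma_def mb_def \<delta>_def]] nv(2)
        by auto
      then show ?thesis
        by (rule paid_tree_expand_degree_2_sym[where w = w and g = g, OF less.prems(1) weight v(2) \<gamma> less.prems(4) nv ma_def mb_def \<delta>_def])
    qed
  qed
qed

section \<open>Trees given by a parent function\<close>

definition parent_tree :: "'a set \<Rightarrow> 'a \<Rightarrow> ('a \<Rightarrow> 'a) \<Rightarrow> 'a pair_pre_digraph" where
  "parent_tree V x \<pi> =
    \<lparr> pverts = V, parcs = {(\<pi> u, u) | u. u \<in> V - {x}} \<union> {(u, \<pi> u) | u. u \<in> V - {x}} \<rparr>"

text \<open>In a closed walk the last arc is followed by the first, hence the index modulo the
  length.\<close>

lemma closed_pcas_nth: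
  assumes "pcas u p u" "i < length p"
  shows "snd (p ! i) = fst (p ! (Suc i mod length p))"
proof -
  have walk: "snd (q ! i) = (if Suc i < length q then fst (q ! Suc i) else z)"
    if "pcas y q z" "i < length q" for y z q i
    using that
  proof (induction q arbitrary: y i)
    case (Cons e q)
    then show ?case by (cases i; cases q) auto
  qed simp
  have "fst (p ! 0) = u" using assms by (cases p) auto
  then show ?thesis using walk[OF assms] assms(2)
    by (cases "Suc i < length p") (auto simp: not_less le_Suc_eq)
qed

text \<open>
  On a cycle of length at least 3, both neighbours of a vertex with maximal \<open>d\<close> would be its parent.
\<close>

lemma no_cycle_parent_tree:
  fixes d :: "'a \<Rightarrow> nat"
  assumes "\<And>u. u \<in> V - {x} \<Longrightarrow> d (\<pi> u) < d u"
    and cycle: "pre_digraph.cycle (with_proj (parent_tree V x \<pi>)) p" and len: "3 \<le> length p"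
  shows False
proof -
  let ?T = "parent_tree V x \<pi>" and ?n = "length p"
  obtain u where "pre_digraph.awalk (with_proj ?T) u p u" and dist: "distinct (tl (pawalk_verts u p))"
    using cycle by (auto simp: pre_digraph.cycle_def awalk_verts_with_proj_eq)
  then have p: "set p \<subseteq> parcs ?T" "pcas u p u"
    by (auto simp: pre_digraph.awalk_def cas_with_proj_eq)
  have "tl (pawalk_verts y q) = map snd q" if "pcas y q z" for y q z
    using that
  proof (induction q arbitrary: y)
    case (Cons e q)
    then show ?case by (cases q) auto
  qed simp
  then have dist: "distinct (map snd p)" using dist p(2) by metis
  have "\<exists>k<?n. \<forall>i<?n. d (snd (p ! i)) \<le> d (snd (p ! k))"
  proof -
    let ?D = "(\<lambda>i. d (snd (p ! i))) ` {..<?n}"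
    have "{..<?n} \<noteq> {}" using len lessThan_empty_iff[of ?n] by linarith
    then have "Max ?D \<in> ?D" by (intro Max_in) auto
    then obtain k where "k < ?n" "Max ?D = d (snd (p ! k))" by auto
    moreover have "d (snd (p ! i)) \<le> Max ?D" if "i < ?n" for i using that by (intro Max_ge) auto
    ultimately show ?thesis by auto
  qed
  then obtain k where k: "k < ?n" "\<And>i. i < ?n \<Longrightarrow> d (snd (p ! i)) \<le> d (snd (p ! k))" by blast
  \<comment> \<open>The cyclic predecessor and successor of \<open>k\<close>, which differ because
    the length is at least 3.\<close>
  define i where "i = (if k = 0 then ?n - 1 else k - 1)"
  define j where "j = (if Suc k = ?n then 0 else Suc k)"
  have ij: "i < ?n" "j < ?n" "i \<noteq> j" using len k(1) by (auto simp: i_def j_def)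
  have "Suc i mod ?n = k" "Suc k mod ?n = j" using len k(1) by (auto simp: i_def j_def)
  then have i: "snd (p ! i) = fst (p ! k)" and j: "snd (p ! k) = fst (p ! j)"
    using closed_pcas_nth[OF p(2) ij(1)] closed_pcas_nth[OF p(2) k(1)] by simp_all
  have arc: "s = \<pi> t \<and> d s < d t \<or> t = \<pi> s \<and> d t < d s" if "(s,t) \<in> set p" for s t
    using that p(1) assms(1) by (auto simp: parent_tree_def)
  have "snd (p ! i) = \<pi> (snd (p ! k))"
    using arc[of "fst (p ! k)" "snd (p ! k)"] k(1) k(2)[OF ij(1)] unfolding i by auto
  moreover have "snd (p ! j) = \<pi> (snd (p ! k))"
    using arc[of "fst (p ! j)" "snd (p ! j)"] ij(2) k(2)[OF ij(2)] by (simp add: j)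
  ultimately have "map snd p ! i = map snd p ! j" using ij by simp
  then show False using dist ij by (simp add: nth_eq_iff_index_eq del: nth_map)
qed

text \<open>Passing to parents decreases \<open>d\<close> and so ends at \<open>x\<close>, which
  gives connectedness.\<close>

lemma parent_tree_spanning:
  fixes d :: "'a \<Rightarrow> nat"
  assumes "pair_graph G" "x \<in> pverts G"
    and parent: "\<And>u. u \<in> pverts G - {x} \<Longrightarrow> (\<pi> u, u) \<in> parcs G \<and> d (\<pi> u) < d u"
  shows "undirected_spanning_tree (parent_tree (pverts G) x \<pi>) G"
proof -
  interpret pair_graph G by fact
  let ?T = "parent_tree (pverts G) x \<pi>"
  have sub: "parcs ?T \<subseteq> parcs G"
    using parent arcs_sym by (auto simp: parent_tree_def)
  have symT: "sym (parcs ?T)" by (auto simp: parent_tree_def sym_def)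
  have graph: "pair_graph ?T"
  proof
    show "finite (parcs ?T)" using sub pair_finite_arcs by (rule finite_subset)
    show "symmetric (with_proj ?T)" using symT by (simp add: symmetric_def)
    fix e assume "e \<in> parcs ?T"
    then have "(fst e, snd e) \<in> parcs G" using sub by auto
    from arc_ends[OF this] show "fst e \<in> pverts ?T" "snd e \<in> pverts ?T" "fst e \<noteq> snd e"
      by (simp_all add: parent_tree_def)
  qed (simp add: parent_tree_def pair_finite_verts)
  have to_x: "(u,x) \<in> rtrancl_on (pverts G) (parcs ?T)" if "u \<in> pverts G" for u
    using that
  proof (induction "d u" arbitrary: u rule: less_induct)
    case less
    show ?case
    proof (cases "u = x")
      case True
      then show ?thesis using less.prems by simp
    next
      case False
      then have u: "(\<pi> u, u) \<in> parcs G" "d (\<pi> u) < d u" using parent less.prems by auto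
      moreover have "(u, \<pi> u) \<in> parcs ?T" using False less.prems by (auto simp: parent_tree_def)
      ultimately show ?thesis
        using less.hyps[OF u(2)] arc_ends[OF u(1)] less.prems
        by (blast intro: converse_rtrancl_on_into_rtrancl_on)
    qed
  qed
  have reach: "(u,v) \<in> rtrancl_on (pverts G) (parcs ?T)" if "u \<in> pverts G" "v \<in> pverts G" for u v
    using to_x[OF that(1)] to_x[OF that(2)] rtrancl_on_sym[OF symT]
    by (blast intro: rtrancl_on_trans dest: symD)
  have "connected (with_proj ?T)"
    unfolding connected_conv
  proof (intro conjI ballI)
    show "verts (with_proj ?T) \<noteq> {}" using assms(2) by (auto simp: parent_tree_def)
    fix u v assume "u \<in> verts (with_proj ?T)" "v \<in> verts (with_proj ?T)"
    then have "u \<in> pverts G" "v \<in> pverts G" by (simp_all add: parent_tree_def)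
    from reach[OF this] show "(u,v) \<in> rtrancl_on (verts (with_proj ?T)) ((arcs_ends (with_proj ?T))\<^sup>s)"
      by (rule rtrancl_on_mono[rotated 2]) (auto simp: symcl_def parent_tree_def)
  qed
  moreover have "\<not> (\<exists>p. pre_digraph.cycle (with_proj ?T) p \<and> 3 \<le> length p)"
    using no_cycle_parent_tree[of "pverts G" x d \<pi>] parent by blast
  moreover have "spanning (with_proj ?T) (with_proj G)"
  proof -
    interpret T: pair_graph ?T by (rule graph)
    have "subgraph (with_proj ?T) (with_proj G)"
      using sub wf_digraph_axioms T.wf_digraph_axioms
      by (intro subgraphI) (auto simp: parent_tree_def compatible_def)
    then show ?thesis by (simp add: spanning_def parent_tree_def)
  qed
  ultimately show ?thesis
    using graph by (simp add: undirected_spanning_tree_def undirected_tree_def)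
qed

section \<open>Degrees, and the return to the unweighted statement\<close>

text \<open>Arcs leaving \<open>v\<close> lead to its children and, except at the root, to its
  parent. The exception yields the sharper bound at \<open>x\<close>.\<close>

lemma degree_parent_tree:
  assumes "finite V"
  shows "degree (parent_tree V x \<pi>) v \<le> card {u \<in> V - {x}. \<pi> u = v} + (if v = x then 0 else 1)"
proof -
  have "out_arcs (with_proj (parent_tree V x \<pi>)) v
      \<subseteq> Pair v ` {u \<in> V - {x}. \<pi> u = v} \<union> (if v = x then {} else {(v, \<pi> v)})"
    by (auto simp: parent_tree_def out_arcs_def)
  then have "degree (parent_tree V x \<pi>) v
      \<le> card (Pair v ` {u \<in> V - {x}. \<pi> u = v} \<union> (if v = x then {} else {(v, \<pi> v)}))"
    unfolding out_degree_def using assms by (intro card_mono) auto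
  also have "\<dots> \<le> card (Pair v ` {u \<in> V - {x}. \<pi> u = v}) + card (if v = x then {} else {(v, \<pi> v)})"
    by (rule card_Un_le)
  also have "card (Pair v ` {u \<in> V - {x}. \<pi> u = v}) = card {u \<in> V - {x}. \<pi> u = v}"
    by (intro card_image) (auto simp: inj_on_def)
  finally show ?thesis by (simp split: if_splits)
qed

lemma card_components_connected:
  assumes "pair_graph G" "connected (with_proj G)"
  shows "card (components (parcs G) (pverts G)) \<le> 1"
proof -
  interpret pair_graph G by fact
  have "strongly_connected (with_proj G)"
    using symmetric_connected_imp_strongly_connected[OF sym_arcs assms(2)] .
  then have "components (parcs G) (pverts G) \<subseteq> {pverts G}"
    by (auto simp: components_def strongly_connected_def reachable_def dest: in_rtrancl_on_in_F)
  then show ?thesis using card_mono[of "{pverts G}"] by fastforce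
qed

theorem theorem1p2:
  fixes G :: "'a pair_pre_digraph" and f :: "'a \<Rightarrow> int" and x :: 'a
  assumes "pair_graph G"
    and "connected (with_proj G)"
    and "K4_minor_free G"
    and "\<And>v. v \<in> pverts G \<Longrightarrow> f v \<ge> 2"
    and "\<And>S. S \<subseteq> pverts G \<Longrightarrow> S \<noteq> {} \<Longrightarrow>
           int (num_components (minus_verts G S)) \<le> (\<Sum>v\<in>S. (f v - 1))"
    and "x \<in> pverts G"
  shows "\<exists>T. undirected_spanning_tree T G \<and>
           (\<forall>v\<in>pverts G. int (degree T v) \<le> f v) \<and>
           int (degree T x) \<le> f x - 1"
proof -
  interpret pair_graph G by fact
  \<comment> \<open>With zero weights and budgets \<open>f v - 1\<close>, the weighted condition is
    the given one multiplied by 2.\<close>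
  have "weighted_tough G (\<lambda>u v. 0) (\<lambda>v. f v - 1)"
    unfolding weighted_tough_def
    using assms(5) by (simp add: num_components_minus_verts[OF assms(1)])
  moreover have "edge_weight G (\<lambda>u v. 0)" by (simp add: edge_weight_def)
  ultimately obtain \<pi> d m where tree: "paid_tree G (\<lambda>u v. 0) (\<lambda>v. f v - 1) x \<pi> d m"
    using paid_tree_exists[OF assms(1,3) card_components_connected[OF assms(1,2)] assms(6)] by blast
  let ?T = "parent_tree (pverts G) x \<pi>"
  have "undirected_spanning_tree ?T G"
    using tree unfolding paid_tree_def by (intro parent_tree_spanning[of G x \<pi> d] assms) blast
  moreover have deg: "int (degree ?T v) \<le> f v - 1 + (if v = x then 0 else 1)" if v: "v \<in> pverts G" for v
  proof -
    \<comment> \<open>Each child of \<open>v\<close> takes at least one unit of the budget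
      \<open>f v - 1\<close>.\<close>
    have "int (card {u \<in> pverts G - {x}. \<pi> u = v}) = (\<Sum>u\<in>{u \<in> pverts G - {x}. \<pi> u = v}. 1)" by simp
    also have "\<dots> \<le> (\<Sum>u\<in>{u \<in> pverts G - {x}. \<pi> u = v}. m v u)"
      using tree by (intro sum_mono) (auto simp: paid_tree_def)
    also have "\<dots> \<le> (\<Sum>u\<in>pverts G. m v u)"
      using tree pair_finite_verts by (intro sum_mono2) (auto simp: paid_tree_def)
    also have "\<dots> \<le> f v - 1"
      using tree v by (simp add: paid_tree_def)
    finally show ?thesis
      using degree_parent_tree[OF pair_finite_verts, of x \<pi> v] by (simp split: if_splits)
  qed
  have "int (degree ?T v) \<le> f v" if "v \<in> pverts G" for v
    using deg[OF that] by (simp split: if_splits)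
  moreover have "int (degree ?T x) \<le> f x - 1" using deg[OF assms(6)] by simp
  ultimately show ?thesis by blast
qed

end
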